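(* There exists a complete intersection of two quadric hypersurfaces and a cubic hypersurface in $\mathbb{P}^6$ (a threefold) whose singular locus consists of exactly $4$ ordinary triple points.
   Context: All varieties are over $\mathbb{C}$. An ordinary triple point on a threefold $X$ is an isolated singularity $O$ of $X$ such that the tangent cone to $X$ at $O$ is a cone over a smooth surface of degree three (a smooth cubic surface in $\mathbb{P}^3$). *)

theory Defs
  imports "HOL-Analysis.Analysis" "HOL-Library.Poly_Mapping"
begin

section \<open>Polynomials in finitely many variables\<close>

text \<open>
  Polynomials over the complex numbers in variables indexed by a finite type \<open>'n\<close>: a monomial is
  its exponent vector, and multiplication is the convolution product of
  \<^theory>\<open>HOL-Library.Poly_Mapping\<close>. Thus \<^typ>\<open>complex ^ 7\<close> carries the homogeneous coordinates of
  \<open>P\<^sup>6\<close>, and the index type \<open>7\<close> indexes these coordinates.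
\<close>

type_synonym 'n cpoly = "('n \<Rightarrow>\<^sub>0 nat) \<Rightarrow>\<^sub>0 complex"

definition pconst :: "complex \<Rightarrow> 'n cpoly" where
  "pconst a = Poly_Mapping.single 0 a"

definition pvar :: "'n \<Rightarrow> 'n cpoly" where
  "pvar i = Poly_Mapping.single (Poly_Mapping.single i 1) 1"

definition peval :: "('n::finite) cpoly \<Rightarrow> complex ^ 'n \<Rightarrow> complex" where
  "peval p x = (\<Sum>m\<in>Poly_Mapping.keys p.
     Poly_Mapping.lookup p m * (\<Prod>i\<in>UNIV. (x $ i) ^ Poly_Mapping.lookup m i))"

definition psubst :: "('n::finite \<Rightarrow> 'k cpoly) \<Rightarrow> 'n cpoly \<Rightarrow> 'k cpoly" where
  "psubst s p = (\<Sum>m\<in>Poly_Mapping.keys p.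
     pconst (Poly_Mapping.lookup p m) * (\<Prod>i\<in>UNIV. s i ^ Poly_Mapping.lookup m i))"

text \<open>The truncated subtraction of exponents below is harmless: if \<open>x\<^sub>i\<close> does not occur in \<open>m\<close>, then
  the coefficient is zero.\<close>

definition pderiv_wrt :: "'n \<Rightarrow> 'n cpoly \<Rightarrow> 'n cpoly" where
  "pderiv_wrt i p = (\<Sum>m\<in>Poly_Mapping.keys p.
     Poly_Mapping.single (m - Poly_Mapping.single i 1)
       (of_nat (Poly_Mapping.lookup m i) * Poly_Mapping.lookup p m))"

definition grad :: "('n::finite) cpoly \<Rightarrow> complex ^ 'n \<Rightarrow> complex ^ 'n" where
  "grad p x = (\<chi> i. peval (pderiv_wrt i p) x)"

definition mon_degree :: "('n::finite \<Rightarrow>\<^sub>0 nat) \<Rightarrow> nat" where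
  "mon_degree m = (\<Sum>i\<in>UNIV. Poly_Mapping.lookup m i)"

definition homogeneous :: "nat \<Rightarrow> ('n::finite) cpoly \<Rightarrow> bool" where
  "homogeneous d p \<longleftrightarrow> (\<forall>m\<in>Poly_Mapping.keys p. mon_degree m = d)"

text \<open>A hypersurface of degree \<open>d\<close> is given by its equation.\<close>

definition hypersurface_eq :: "nat \<Rightarrow> ('n::finite) cpoly \<Rightarrow> bool" where
  "hypersurface_eq d p \<longleftrightarrow> p \<noteq> 0 \<and> homogeneous d p"

text \<open>\<open>ideal.span A\<close> is the ideal generated by \<open>A\<close>.\<close>

interpretation ideal: module "(*) :: 'a::comm_ring_1 \<Rightarrow> 'a \<Rightarrow> 'a"
  by unfold_locales (simp_all add: algebra_simps)


section \<open>Complete intersections and their singular points\<close>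

text \<open>
  The closed subscheme of projective space cut out by the forms \<open>fs\<close> is a complete intersection if
  \<open>fs\<close> is a regular sequence. It then has pure codimension \<open>length fs\<close>; in particular three forms
  in seven variables give a threefold in \<open>P\<^sup>6\<close>.
\<close>

definition complete_intersection :: "('n::finite) cpoly list \<Rightarrow> bool" where
  "complete_intersection fs \<longleftrightarrow>
     ideal.span (set fs) \<noteq> UNIV \<and>
     (\<forall>k<length fs. \<forall>g. g * fs ! k \<in> ideal.span (set (take k fs))
        \<longrightarrow> g \<in> ideal.span (set (take k fs)))"

text \<open>
  A point of projective space is a line \<^term>\<open>vec.span {v}\<close> through the origin. The dimension of the span
  of the gradients is the rank of the Jacobian matrix of \<open>fs\<close>; a point of a complete intersection is
  nonsingular iff this rank equals the codimension \<open>length fs\<close>.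
\<close>

definition singular_locus :: "('n::finite) cpoly list \<Rightarrow> (complex ^ 'n) set set" where
  "singular_locus fs = {vec.span {v} | v. v \<noteq> 0 \<and> (\<forall>f\<in>set fs. peval f v = 0) \<and>
     vec.dim ((\<lambda>f. grad f v) ` set fs) < length fs}"

text \<open>Isolated in the singular locus, for the Zariski topology: some form \<open>h\<close> vanishes at all
  singular points other than \<open>P\<close>, but not at \<open>P\<close>.\<close>

definition isolated_singular_point :: "('n::finite) cpoly list \<Rightarrow> (complex ^ 'n) set \<Rightarrow> bool" where
  "isolated_singular_point fs P \<longleftrightarrow> P \<in> singular_locus fs \<and>
     (\<exists>d h. homogeneous d h \<and> (\<exists>v\<in>P. peval h v \<noteq> 0) \<and>
        (\<forall>R\<in>singular_locus fs - {P}. \<forall>v\<in>R. peval h v = 0))"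


section \<open>Tangent cones and ordinary triple points\<close>

text \<open>The nonzero homogeneous component of lowest degree; the initial form of \<open>0\<close> is \<open>0\<close>.\<close>

definition initial_form :: "('n::finite) cpoly \<Rightarrow> 'n cpoly" where
  "initial_form p =
     (\<Sum>m\<in>{m \<in> Poly_Mapping.keys p. mon_degree m = Min (mon_degree ` Poly_Mapping.keys p)}.
        Poly_Mapping.single m (Poly_Mapping.lookup p m))"

text \<open>
  The ideal of the tangent cone at \<open>v\<close> of the affine scheme \<open>V(I)\<close>: translate \<open>v\<close> to the origin and
  take the ideal generated by the initial forms of all elements of the ideal (not only of a set
  of generators).
\<close>

definition tangent_cone_ideal :: "('n::finite) cpoly set \<Rightarrow> complex ^ 'n \<Rightarrow> 'n cpoly set" where
  "tangent_cone_ideal I v =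
     ideal.span ((\<lambda>f. initial_form (psubst (\<lambda>i. pvar i + pconst (v $ i)) f)) ` I)"

text \<open>
  The ideal \<open>J\<close> defines, scheme-theoretically, the affine cone over a smooth cubic surface \<open>F = 0\<close> in \<open>P\<^sup>3\<close>,
  with the four-dimensional affine space containing this cone embedded linearly by the matrix \<open>M\<close>:
  a polynomial is in \<open>J\<close> iff its pullback along \<open>M\<close> is in the ideal generated by \<open>F\<close>.
\<close>

definition cone_over_smooth_cubic_surface :: "('n::finite) cpoly set \<Rightarrow> bool" where
  "cone_over_smooth_cubic_surface J \<longleftrightarrow>
     (\<exists>(M :: complex ^ 4 ^ 'n) (F :: 4 cpoly).
        rank M = 4 \<and> hypersurface_eq 3 F \<and> singular_locus [F] = {} \<and>
        J = {g. psubst (\<lambda>i. \<Sum>j\<in>UNIV. pconst (M $ i $ j) * pvar j) g \<in> ideal.span {F}})"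

text \<open>
  The standard affine chart \<open>x\<^sub>i \<noteq> 0\<close> of the projective scheme defined by \<open>fs\<close> is realised as the closed
  subscheme of affine space with equations \<open>fs\<close> and \<open>x\<^sub>i = 1\<close>. The tangent cone at \<open>P\<close> is
  computed in such a chart, at the representative \<open>v\<close> of \<open>P\<close> with \<open>v\<^sub>i = 1\<close>; up to linear
  isomorphism it does not depend on the choice of \<open>i\<close>.
\<close>

definition ordinary_triple_point :: "('n::finite) cpoly list \<Rightarrow> (complex ^ 'n) set \<Rightarrow> bool" where
  "ordinary_triple_point fs P \<longleftrightarrow> isolated_singular_point fs P \<and>
     (\<exists>v i. P = vec.span {v} \<and> v $ i = 1 \<and>
        cone_over_smooth_cubic_surface
          (tangent_cone_ideal (ideal.span (insert (pvar i - 1) (set fs))) v))"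

end

theory Submission
  imports Defs
begin

text \<open>
  Split the coordinates of \<open>P\<^sup>6\<close> as \<open>y\<^sub>0, y\<^sub>1, y\<^sub>2\<close> and \<open>u\<^sub>1, \<dots>, u\<^sub>4\<close>. A smooth cubic form \<open>F(u)\<close>, read in
  all seven variables, defines the cone over a smooth cubic surface whose vertex is the plane \<open>u = 0\<close>.
  Two quadrics that meet this plane transversally in four points intersect in a fourfold that is smooth at
  these points and has \<open>u\<close> as local coordinates there. In these coordinates the equation \<open>F(u) = 0\<close> is that of the cone over the
  cubic surface. Off the plane the cubic hypersurface is smooth, and general
  quadrics cut it transversally by Bertini's theorem. So the four points are the only singularities, and
  they are ordinary triple points.

  The instance used is the Fermat cubic \<open>u\<^sub>1\<^sup>3 + \<dots> + u\<^sub>4\<^sup>3\<close> with the diagonal quadrics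
  \<open>y\<^sub>1\<^sup>2 - y\<^sub>0\<^sup>2 + \<Sum> j u\<^sub>j\<^sup>2\<close> and \<open>y\<^sub>2\<^sup>2 - y\<^sub>0\<^sup>2 + \<Sum> u\<^sub>j\<^sup>2\<close>; the four points are \<open>(1 : \<plusminus>1 : \<plusminus>1 : 0 : 0 : 0 : 0)\<close>. Three
  computations carry the proof.

  \<^item> Regular sequence: the quadrics are monic quadratic in \<open>y\<^sub>1\<close> and in \<open>y\<^sub>2\<close> respectively, each is free of
    the other's leading variable, and the cubic is free of both. Remainders of division by the quadrics are linear over
    polynomials free of the leading variable, so multiplication by such a polynomial is injective modulo the
    quadrics (\<open>regular_mod_two_quadrics\<close>).

  \<^item> No other singular points: here Bertini's theorem is replaced by \<open>fermat_pencil_no_singularity\<close>. For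
    diagonal equations a relation between the gradients in general leaves for each \<open>u\<^sub>j\<close> only the choice between \<open>0\<close> and
    a fixed affine function of the weight \<open>j\<close>. Since the weights are real and positive, a comparison of
    real and imaginary parts leaves only \<open>u = 0\<close>.

  \<^item> Tangent cones: the initial forms of the translated equations generate an ideal that contains the ideal
    of the cone. For the converse, an arbitrary element of the ideal is pulled back to the \<open>u\<close>-space
    along a polynomial map that solves the two quadric equations up to a prescribed order
    (\<open>approximate_root\<close>); its lowest-order part shows that the initial form restricted to the tangent
    space is a multiple of \<open>F\<close> (\<open>initial_form_pullback_in_span\<close>).
\<close>

section \<open>Evaluation, substitution and partial derivatives\<close>

text \<open>As a simplification rule, this instance for multiplication moves parentheses to the left. It then
  undoes \<open>mult.assoc\<close>, and simplification with \<open>algebra_simps\<close> does not terminate.\<close>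

declare ideal.scale_scale [simp del]

lemma sum_keys_add:
  assumes "\<And>m. f m 0 = 0" "\<And>m a b. f m (a + b) = f m a + f m b"
  shows "(\<Sum>m\<in>Poly_Mapping.keys (p + q). f m (Poly_Mapping.lookup (p + q) m))
    = (\<Sum>m\<in>Poly_Mapping.keys p. f m (Poly_Mapping.lookup p m))
    + (\<Sum>m\<in>Poly_Mapping.keys q. f m (Poly_Mapping.lookup q m))"
  by (rule setsum_keys_plus_distrib) (use assms in auto)

lemma sum_keys_single:
  assumes "f m 0 = 0"
  shows "(\<Sum>k\<in>Poly_Mapping.keys (Poly_Mapping.single m c). f k (Poly_Mapping.lookup (Poly_Mapping.single m c) k)) = f m c"
  using assms by (cases "c = 0") auto

lemma poly_induct [case_names single add]:
  fixes p :: "'m \<Rightarrow>\<^sub>0 'c::comm_monoid_add"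
  assumes single: "\<And>m c. P (Poly_Mapping.single m c)"
    and add: "\<And>p q. P p \<Longrightarrow> P q \<Longrightarrow> P (p + q)"
  shows "P p"
proof (induction p rule: update_induct)
  case const
  show ?case using single[of undefined 0] by simp
next
  case (update p m c)
  have "Poly_Mapping.update m c p = p + Poly_Mapping.single m c"
    using update.hyps
    by (intro poly_mapping_eqI) (auto simp: lookup_update lookup_add lookup_single in_keys_iff when_def)
  then show ?case using add[OF update.IH single] by simp
qed

text \<open>A map on terms that is additive in the coefficient and multiplicative in monomial and coefficient
  jointly extends to a ring homomorphism. Evaluation and substitution are both of this kind.\<close>

lemma sum_keys_mult:
  fixes f :: "'m::comm_monoid_add \<Rightarrow> 'c::comm_semiring_0 \<Rightarrow> 'b::comm_semiring_0"
  assumes f0: "\<And>m. f m 0 = 0" and fa: "\<And>m a b. f m (a + b) = f m a + f m b"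
    and fm: "\<And>m n a b. f (m + n) (a * b) = f m a * f n b"
  shows "(\<Sum>m\<in>Poly_Mapping.keys (p * q). f m (Poly_Mapping.lookup (p * q) m))
    = (\<Sum>m\<in>Poly_Mapping.keys p. f m (Poly_Mapping.lookup p m))
    * (\<Sum>m\<in>Poly_Mapping.keys q. f m (Poly_Mapping.lookup q m))"
proof (induction p rule: poly_induct)
  case (single m c)
  show ?case
  proof (induction q rule: poly_induct)
    case (single n d)
    show ?case
      by (simp only: mult_single sum_keys_single[of f, OF f0] fm)
  next
    case (add q r)
    then show ?case
      by (simp add: distrib_left sum_keys_add[of f, OF f0 fa])
  qed
next
  case (add p r)
  then show ?case
    by (simp add: distrib_right sum_keys_add[of f, OF f0 fa])
qed

lemma lookup_power_prod_add:
  fixes s :: "'n::finite \<Rightarrow> 'b::comm_monoid_mult"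
  shows "(\<Prod>i\<in>UNIV. s i ^ Poly_Mapping.lookup (m + n) i)
    = (\<Prod>i\<in>UNIV. s i ^ Poly_Mapping.lookup m i) * (\<Prod>i\<in>UNIV. s i ^ Poly_Mapping.lookup n i)"
  by (simp add: lookup_add power_add prod.distrib)

lemma prod_power_single:
  fixes s :: "'n::finite \<Rightarrow> 'b::comm_monoid_mult"
  shows "(\<Prod>i\<in>UNIV. s i ^ Poly_Mapping.lookup (Poly_Mapping.single j 1) i) = s j"
proof -
  have "(\<Prod>i\<in>UNIV. s i ^ Poly_Mapping.lookup (Poly_Mapping.single j 1) i) = (\<Prod>i\<in>UNIV. if i = j then s i else 1)"
    by (intro prod.cong) (auto simp: lookup_single when_def)
  then show ?thesis by simp
qed

lemma pconst_0 [simp]: "pconst 0 = 0" by (simp add: pconst_def)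
lemma pconst_1 [simp]: "pconst 1 = 1" by (simp add: pconst_def)
lemma pconst_add: "pconst (a + b) = pconst a + pconst b" by (simp add: pconst_def single_add)
lemma pconst_mult: "pconst (a * b) = pconst a * pconst b" by (simp add: pconst_def mult_single)
lemma pconst_numeral [simp]: "pconst (numeral k) = numeral k" by (simp add: pconst_def)

lemma single_conv_pconst: "Poly_Mapping.single m c = pconst c * Poly_Mapping.single m 1"
  by (simp add: pconst_def mult_single)


lemma psubst_add: "psubst s (p + q) = psubst s p + psubst s q"
  unfolding psubst_def by (rule sum_keys_add) (simp_all add: pconst_add distrib_right)

lemma psubst_mult: "psubst s (p * q) = psubst s p * psubst s q"
  unfolding psubst_def
  by (rule sum_keys_mult[of "\<lambda>m c. pconst c * (\<Prod>i\<in>UNIV. s i ^ Poly_Mapping.lookup m i)"])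
    (simp_all only: pconst_0 pconst_add pconst_mult distrib_right lookup_power_prod_add mult_ac mult_zero_left)

lemma psubst_single:
  "psubst s (Poly_Mapping.single m c) = pconst c * (\<Prod>i\<in>UNIV. s i ^ Poly_Mapping.lookup m i)"
  unfolding psubst_def
  by (rule sum_keys_single[of "\<lambda>m c. pconst c * (\<Prod>i\<in>UNIV. s i ^ Poly_Mapping.lookup m i)"]) simp

lemma psubst_pconst [simp]: "psubst s (pconst c) = pconst c"
  by (simp add: pconst_def[of c] psubst_single) 

lemma psubst_pvar [simp]: "psubst s (pvar i) = s i"
  using psubst_single[of s "Poly_Mapping.single i 1" 1] prod_power_single[of s i]
  by (simp add: pvar_def)

lemma psubst_0 [simp]: "psubst s 0 = 0" by (simp add: psubst_def)
lemma psubst_1 [simp]: "psubst s 1 = 1" using psubst_pconst[of s 1] by simp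
lemma psubst_numeral [simp]: "psubst s (numeral k) = numeral k"
  using psubst_pconst[of s "numeral k"] by simp
lemma psubst_uminus: "psubst s (- p) = - psubst s p"
  using psubst_add[of s p "- p"] by (simp add: eq_neg_iff_add_eq_0 add.commute)
lemma psubst_diff: "psubst s (p - q) = psubst s p - psubst s q"
  using psubst_add[of s p "- q"] by (simp add: psubst_uminus)
lemma psubst_power: "psubst s (p ^ k) = psubst s p ^ k"
  by (induction k) (simp_all add: psubst_mult)

lemmas psubst_hom = psubst_add psubst_mult psubst_uminus psubst_diff psubst_power

lemma psubst_sum: "psubst s (\<Sum>i\<in>A. f i) = (\<Sum>i\<in>A. psubst s (f i))"
  by (induction A rule: infinite_finite_induct) (auto simp: psubst_add)
lemma psubst_prod: "psubst s (\<Prod>i\<in>A. f i) = (\<Prod>i\<in>A. psubst s (f i))"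
  by (induction A rule: infinite_finite_induct) (auto simp: psubst_mult)

lemma peval_add: "peval (p + q) x = peval p x + peval q x"
  unfolding peval_def by (rule sum_keys_add) (simp_all add: distrib_right)

lemma peval_mult: "peval (p * q) x = peval p x * peval q x"
  unfolding peval_def
  by (rule sum_keys_mult[of "\<lambda>m c. c * (\<Prod>i\<in>UNIV. (x $ i) ^ Poly_Mapping.lookup m i)"])
    (simp_all only: distrib_right lookup_power_prod_add mult_ac mult_zero_left)

lemma peval_single:
  "peval (Poly_Mapping.single m c) x = c * (\<Prod>i\<in>UNIV. (x $ i) ^ Poly_Mapping.lookup m i)"
  unfolding peval_def
  by (rule sum_keys_single[of "\<lambda>m c. c * (\<Prod>i\<in>UNIV. (x $ i) ^ Poly_Mapping.lookup m i)"]) simp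

lemma peval_pconst [simp]: "peval (pconst c) x = c"
  by (simp add: pconst_def[of c] peval_single) 

lemma peval_pvar [simp]: "peval (pvar i) x = x $ i"
  using peval_single[of "Poly_Mapping.single i 1" 1 x] prod_power_single[of "($) x" i]
  by (simp add: pvar_def)

lemma peval_0 [simp]: "peval 0 x = 0" by (simp add: peval_def)
lemma peval_1 [simp]: "peval 1 x = 1" using peval_pconst[of 1 x] by simp
lemma peval_numeral [simp]: "peval (numeral k) x = numeral k"
  using peval_pconst[of "numeral k" x] by simp
lemma peval_uminus: "peval (- p) x = - peval p x"
  using peval_add[of p "- p" x] by (simp add: eq_neg_iff_add_eq_0 add.commute)
lemma peval_diff: "peval (p - q) x = peval p x - peval q x"
  using peval_add[of p "- q" x] by (simp add: peval_uminus)
lemma peval_power: "peval (p ^ k) x = peval p x ^ k"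
  by (induction k) (simp_all add: peval_mult)

lemmas peval_hom = peval_add peval_mult peval_uminus peval_diff peval_power

lemma pderiv_wrt_add: "pderiv_wrt i (p + q) = pderiv_wrt i p + pderiv_wrt i q"
  unfolding pderiv_wrt_def by (rule sum_keys_add) (simp_all add: distrib_left single_add)

lemma pderiv_wrt_single:
  "pderiv_wrt i (Poly_Mapping.single m c) = Poly_Mapping.single (m - Poly_Mapping.single i 1) (of_nat (Poly_Mapping.lookup m i) * c)"
  unfolding pderiv_wrt_def
  by (rule sum_keys_single[of "\<lambda>m c. Poly_Mapping.single (m - Poly_Mapping.single i 1) (of_nat (Poly_Mapping.lookup m i) * c)"]) simp

lemma pderiv_wrt_mult:
  "pderiv_wrt i (p * q) = pderiv_wrt i p * q + p * pderiv_wrt i q"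
proof (induction p rule: poly_induct)
  case (single m c)
  show ?case
  proof (induction q rule: poly_induct)
    case (single n d)
    let ?e = "Poly_Mapping.single i (1::nat)"
    \<comment> \<open>Truncated subtraction commutes with the addition of \<open>l\<close>, except where the coefficient is zero.\<close>
    have shift: "Poly_Mapping.single (k - ?e + l) (of_nat (Poly_Mapping.lookup k i) * z)
        = Poly_Mapping.single (k + l - ?e) (of_nat (Poly_Mapping.lookup k i) * z)" 
      for k l :: "'a \<Rightarrow>\<^sub>0 nat" and z :: complex
    proof (cases "Poly_Mapping.lookup k i = 0")
      case False
      then have "k - ?e + l = k + l - ?e"
        by (intro poly_mapping_eqI) (auto simp: lookup_add lookup_minus lookup_single when_def)
      then show ?thesis by simp
    qed simp
    let ?S = "Poly_Mapping.single (m + n - ?e)"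
    have "pderiv_wrt i (Poly_Mapping.single m c * Poly_Mapping.single n d)
        = ?S (of_nat (Poly_Mapping.lookup m i) * (c * d)) + ?S (of_nat (Poly_Mapping.lookup n i) * (c * d))"
      by (simp only: mult_single pderiv_wrt_single lookup_add of_nat_add distrib_right single_add)
    also have "\<dots> = Poly_Mapping.single (m - ?e + n) (of_nat (Poly_Mapping.lookup m i) * (c * d))
        + Poly_Mapping.single (m + (n - ?e)) (of_nat (Poly_Mapping.lookup n i) * (c * d))"
      using shift[of m n "c * d"] shift[of n m "c * d"] by (simp only: add.commute[of n m] add.commute[of _ m])
    also have "\<dots> = pderiv_wrt i (Poly_Mapping.single m c) * Poly_Mapping.single n d
        + Poly_Mapping.single m c * pderiv_wrt i (Poly_Mapping.single n d)"
      by (simp only: mult_single pderiv_wrt_single mult.assoc mult.left_commute[of c])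
    finally show ?case .
  next
    case (add q r)
    then show ?case
      by (simp add: distrib_left pderiv_wrt_add algebra_simps)
  qed
next
  case (add p r)
  then show ?case
    by (simp add: distrib_right pderiv_wrt_add algebra_simps)
qed

lemma pderiv_wrt_pconst [simp]: "pderiv_wrt i (pconst c) = 0"
  by (simp add: pconst_def pderiv_wrt_single)
lemma pderiv_wrt_pvar: "pderiv_wrt i (pvar j) = (if i = j then 1 else 0)"
  by (simp add: pvar_def pderiv_wrt_single lookup_single when_def)
lemma pderiv_wrt_0 [simp]: "pderiv_wrt i 0 = 0" by (simp add: pderiv_wrt_def)
lemma pderiv_wrt_uminus: "pderiv_wrt i (- p) = - pderiv_wrt i p"
  using pderiv_wrt_add[of i p "- p"] by (simp add: eq_neg_iff_add_eq_0 add.commute)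
lemma pderiv_wrt_diff: "pderiv_wrt i (p - q) = pderiv_wrt i p - pderiv_wrt i q"
  using pderiv_wrt_add[of i p "- q"] by (simp add: pderiv_wrt_uminus)

lemma pderiv_wrt_power2: "pderiv_wrt i (p ^ 2) = 2 * p * pderiv_wrt i p"
  by (simp add: power2_eq_square pderiv_wrt_mult algebra_simps)

lemma pderiv_wrt_power3: "pderiv_wrt i (p ^ 3) = 3 * p ^ 2 * pderiv_wrt i p"
  by (simp add: power3_eq_cube power2_eq_square pderiv_wrt_mult algebra_simps)

lemma peval_sum: "peval (\<Sum>i\<in>A. f i) x = (\<Sum>i\<in>A. peval (f i) x)"
  by (induction A rule: infinite_finite_induct) (auto simp: peval_add)
lemma pderiv_wrt_sum: "pderiv_wrt k (\<Sum>i\<in>A. f i) = (\<Sum>i\<in>A. pderiv_wrt k (f i))"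
  by (induction A rule: infinite_finite_induct) (auto simp: pderiv_wrt_add)

lemmas pderiv_wrt_rules = pderiv_wrt_add pderiv_wrt_mult pderiv_wrt_uminus pderiv_wrt_diff pderiv_wrt_power2 pderiv_wrt_power3 pderiv_wrt_pvar

section \<open>Degree, order and initial forms\<close>

lemma mon_degree_0 [simp]: "mon_degree 0 = 0" by (simp add: mon_degree_def)
lemma mon_degree_add: "mon_degree (m + n) = mon_degree m + mon_degree n"
  by (simp add: mon_degree_def lookup_add sum.distrib)
lemma mon_degree_single [simp]: "mon_degree (Poly_Mapping.single i k) = k"
proof -
  have "mon_degree (Poly_Mapping.single i k) = (\<Sum>j\<in>UNIV. if j = i then k else 0)"
    unfolding mon_degree_def by (intro sum.cong) (auto simp: lookup_single when_def)
  then show ?thesis by simp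
qed

text \<open>Vanishing to order at least \<open>n\<close> at the origin. A lower bound is used in place of an order function, so
  that the zero polynomial, of infinite order, needs no separate treatment.\<close>

definition ord_ge :: "nat \<Rightarrow> ('n::finite) cpoly \<Rightarrow> bool" where
  "ord_ge n p \<longleftrightarrow> (\<forall>m\<in>Poly_Mapping.keys p. n \<le> mon_degree m)"

lemma ord_ge_0 [simp]: "ord_ge n 0" by (simp add: ord_ge_def)
lemma ord_ge_zero [simp]: "ord_ge 0 p" by (simp add: ord_ge_def)
lemma ord_ge_mono: "ord_ge n p \<Longrightarrow> k \<le> n \<Longrightarrow> ord_ge k p" by (auto simp: ord_ge_def)
lemma ord_ge_add: "ord_ge n p \<Longrightarrow> ord_ge n q \<Longrightarrow> ord_ge n (p + q)"
  using keys_add[of p q] by (auto simp: ord_ge_def)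
lemma ord_ge_uminus: "ord_ge n p \<Longrightarrow> ord_ge n (- p)"
  by (simp add: ord_ge_def in_keys_iff)
lemma ord_ge_diff: "ord_ge n p \<Longrightarrow> ord_ge n q \<Longrightarrow> ord_ge n (p - q)"
  using ord_ge_add[of n p "- q"] by (simp add: ord_ge_uminus)
lemma ord_ge_sum: "(\<And>i. i \<in> A \<Longrightarrow> ord_ge n (f i)) \<Longrightarrow> ord_ge n (\<Sum>i\<in>A. f i)"
  by (induction A rule: infinite_finite_induct) (auto intro: ord_ge_add)
lemma ord_ge_mult: "ord_ge n p \<Longrightarrow> ord_ge k q \<Longrightarrow> ord_ge (n + k) (p * q)"
  using keys_mult[of p q] by (fastforce simp: ord_ge_def mon_degree_add intro: add_mono)
lemma ord_ge_mult_left: "ord_ge n q \<Longrightarrow> ord_ge n (p * q)"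
  using ord_ge_mult[of 0 p n q] by simp

lemma homogeneous_ord_ge: "homogeneous n p \<Longrightarrow> ord_ge n p"
  by (auto simp: ord_ge_def homogeneous_def)

lemma homogeneous_0 [simp]: "homogeneous d 0" by (simp add: homogeneous_def)
lemma homogeneous_add: "homogeneous n p \<Longrightarrow> homogeneous n q \<Longrightarrow> homogeneous n (p + q)"
  using keys_add[of p q] by (auto simp: homogeneous_def)
lemma homogeneous_uminus: "homogeneous n p \<Longrightarrow> homogeneous n (- p)"
  by (simp add: homogeneous_def in_keys_iff)
lemma homogeneous_diff: "homogeneous n p \<Longrightarrow> homogeneous n q \<Longrightarrow> homogeneous n (p - q)"
  using homogeneous_add[of n p "- q"] by (simp add: homogeneous_uminus)
lemma homogeneous_sum: "(\<And>i. i \<in> A \<Longrightarrow> homogeneous n (f i)) \<Longrightarrow> homogeneous n (\<Sum>i\<in>A. f i)"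
  by (induction A rule: infinite_finite_induct) (auto intro: homogeneous_add)
lemma homogeneous_mult: "homogeneous n p \<Longrightarrow> homogeneous k q \<Longrightarrow> homogeneous (n + k) (p * q)"
  using keys_mult[of p q] by (fastforce simp: homogeneous_def mon_degree_add)
lemma homogeneous_single: "mon_degree m = d \<Longrightarrow> homogeneous d (Poly_Mapping.single m c)"
  by (simp add: homogeneous_def)
lemma homogeneous_pconst [simp]: "homogeneous 0 (pconst c)"
  by (simp add: pconst_def homogeneous_single)
lemma homogeneous_pvar [simp]: "homogeneous 1 (pvar i)"
  by (simp add: pvar_def homogeneous_single)
lemma homogeneous_power: "homogeneous n p \<Longrightarrow> homogeneous (n * k) (p ^ k)"
proof (induction k)
  case 0
  then show ?case using homogeneous_pconst[of 1] by simp
next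
  case (Suc k)
  then show ?case using homogeneous_mult[of n p "n * k" "p ^ k"] by simp
qed
lemma homogeneous_pconst_mult: "homogeneous d p \<Longrightarrow> homogeneous d (pconst c * p)"
  using homogeneous_mult[OF homogeneous_pconst] by fastforce
lemma homogeneous_pvar_power: "homogeneous k (pvar i ^ k)"
  using homogeneous_power[OF homogeneous_pvar[of i], of k] by simp

definition hom_part :: "nat \<Rightarrow> ('n::finite) cpoly \<Rightarrow> 'n cpoly" where
  "hom_part d p = (\<Sum>m\<in>Poly_Mapping.keys p. if mon_degree m = d then Poly_Mapping.single m (Poly_Mapping.lookup p m) else 0)"

lemma hom_part_add: "hom_part d (p + q) = hom_part d p + hom_part d q"
  unfolding hom_part_def by (rule sum_keys_add) (simp_all add: single_add)
lemma hom_part_0 [simp]: "hom_part d 0 = 0" by (simp add: hom_part_def)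
lemma hom_part_uminus: "hom_part d (- p) = - hom_part d p"
  using hom_part_add[of d p "- p"] by (simp add: eq_neg_iff_add_eq_0 add.commute)
lemma hom_part_diff: "hom_part d (p - q) = hom_part d p - hom_part d q"
  using hom_part_add[of d p "- q"] by (simp add: hom_part_uminus)
lemma lookup_hom_part: "Poly_Mapping.lookup (hom_part d p) m = (if mon_degree m = d then Poly_Mapping.lookup p m else 0)"
proof (induction p rule: poly_induct)
  case (single n c)
  have "hom_part d (Poly_Mapping.single n c) = (if mon_degree n = d then Poly_Mapping.single n c else 0)"
    unfolding hom_part_def
    by (rule sum_keys_single[of "\<lambda>m c. if mon_degree m = d then Poly_Mapping.single m c else 0"]) simp
  then show ?case by (auto simp: lookup_single when_def)
next
  case (add p q)
  then show ?case by (simp add: hom_part_add lookup_add)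
qed

lemma homogeneous_hom_part: "homogeneous d (hom_part d p)"
  by (auto simp: homogeneous_def in_keys_iff lookup_hom_part split: if_splits)
lemma hom_part_homogeneous: "homogeneous e p \<Longrightarrow> hom_part d p = (if d = e then p else 0)"
  by (intro poly_mapping_eqI) (auto simp: homogeneous_def in_keys_iff lookup_hom_part)
lemma hom_part_ord_ge: "ord_ge n p \<Longrightarrow> d < n \<Longrightarrow> hom_part d p = 0"
  by (intro poly_mapping_eqI) (force simp: ord_ge_def in_keys_iff lookup_hom_part)

text \<open>A principal ideal generated by a form is a homogeneous ideal. It suffices to look at a monomial multiple
  of the form, which is itself homogeneous, so that its component of degree \<open>d\<close> is either all of it or zero.\<close>

lemma hom_part_mult_in_span:
  assumes "homogeneous e F"
  shows "hom_part d (p * F) \<in> ideal.span {F}"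
proof (induction p rule: poly_induct)
  case (single m c)
  let ?p = "Poly_Mapping.single m c * F"
  have "homogeneous (mon_degree m + e) ?p"
    using assms by (intro homogeneous_mult homogeneous_single) auto
  then have "hom_part d ?p = ?p \<or> hom_part d ?p = 0"
    by (auto simp: hom_part_homogeneous)
  moreover have "?p \<in> ideal.span {F}"
    by (intro ideal.span_scale ideal.span_base) simp
  ultimately show ?case using ideal.span_zero by metis
next
  case (add p q)
  then show ?case by (simp add: distrib_right hom_part_add ideal.span_add)
qed

lemma initial_form_conv_hom_part:
  "initial_form p = hom_part (Min (mon_degree ` Poly_Mapping.keys p)) p"
  unfolding initial_form_def hom_part_def by (simp add: sum.inter_filter)

lemma initial_form_0 [simp]: "initial_form 0 = 0" by (simp add: initial_form_def)

lemma initial_form_decomp: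
  obtains d where "homogeneous d (initial_form p)" "ord_ge (Suc d) (p - initial_form p)"
proof -
  let ?d = "Min (mon_degree ` Poly_Mapping.keys p)"
  have "homogeneous ?d (initial_form p)"
    by (simp add: initial_form_conv_hom_part homogeneous_hom_part)
  moreover have "ord_ge (Suc ?d) (p - initial_form p)"
    unfolding ord_ge_def
  proof
    fix m assume "m \<in> Poly_Mapping.keys (p - initial_form p)"
    then have *: "mon_degree m \<noteq> ?d" "m \<in> Poly_Mapping.keys p"
      by (auto simp: in_keys_iff lookup_minus initial_form_conv_hom_part lookup_hom_part split: if_splits)
    then have "?d \<le> mon_degree m" by (intro Min_le) auto
    with * show "Suc ?d \<le> mon_degree m" by linarith
  qed
  ultimately show ?thesis by (rule that)
qed

lemma initial_form_eqI:
  assumes "homogeneous d p" "p \<noteq> 0" "ord_ge (Suc d) r"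
  shows "initial_form (p + r) = p"
proof -
  have part: "hom_part d (p + r) = p"
    using assms by (simp add: hom_part_add hom_part_homogeneous[of d] hom_part_ord_ge)
  have ge: "ord_ge d (p + r)"
    using ord_ge_add[OF homogeneous_ord_ge[OF assms(1)] ord_ge_mono[OF assms(3)]] by simp
  obtain m where "Poly_Mapping.lookup p m \<noteq> 0"
    using assms(2) by (metis poly_mapping_eqI lookup_zero)
  then have "mon_degree m = d" "m \<in> Poly_Mapping.keys (p + r)"
    using part by (metis lookup_hom_part in_keys_iff)+
  then have "Min (mon_degree ` Poly_Mapping.keys (p + r)) = d"
    using ge by (intro Min_eqI) (auto simp: ord_ge_def)
  then show ?thesis using part by (simp add: initial_form_conv_hom_part)
qed

section \<open>Regular sequences from quadrics monic in one variable\<close>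

lemma sum_singles: "(\<Sum>m\<in>Poly_Mapping.keys p. Poly_Mapping.single m (Poly_Mapping.lookup p m)) = p"
proof (induction p rule: poly_induct)
  case (single m c)
  show ?case by (rule sum_keys_single[of Poly_Mapping.single]) simp
next
  case (add p q)
  have "(\<Sum>m\<in>Poly_Mapping.keys (p + q). Poly_Mapping.single m (Poly_Mapping.lookup (p + q) m))
    = (\<Sum>m\<in>Poly_Mapping.keys p. Poly_Mapping.single m (Poly_Mapping.lookup p m))
    + (\<Sum>m\<in>Poly_Mapping.keys q. Poly_Mapping.single m (Poly_Mapping.lookup q m))"
    by (rule sum_keys_add) (simp_all add: single_add)
  then show ?case using add by simp
qed

definition free_of :: "'n \<Rightarrow> 'n cpoly \<Rightarrow> bool" where
  "free_of x p \<longleftrightarrow> (\<forall>m\<in>Poly_Mapping.keys p. Poly_Mapping.lookup m x = 0)"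

lemma free_of_add: "free_of x p \<Longrightarrow> free_of x q \<Longrightarrow> free_of x (p + q)"
  using keys_add[of p q] by (auto simp: free_of_def)
lemma free_of_uminus: "free_of x p \<Longrightarrow> free_of x (- p)"
  by (simp add: free_of_def in_keys_iff)
lemma free_of_diff: "free_of x p \<Longrightarrow> free_of x q \<Longrightarrow> free_of x (p - q)"
  using free_of_add[of x p "- q"] by (simp add: free_of_uminus)
lemma free_of_mult: "free_of x p \<Longrightarrow> free_of x q \<Longrightarrow> free_of x (p * q)"
  using keys_mult[of p q] by (fastforce simp: free_of_def lookup_add)
lemma free_of_pconst: "free_of x (pconst c)"
  by (simp add: free_of_def pconst_def)
lemma free_of_pvar: "i \<noteq> x \<Longrightarrow> free_of x (pvar i)"
  by (simp add: free_of_def pvar_def lookup_single)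
lemma free_of_power: "free_of x p \<Longrightarrow> free_of x (p ^ k)"
  using free_of_pconst[of x 1] by (induction k) (auto intro: free_of_mult)

lemma free_of_sum: "(\<And>i. i \<in> A \<Longrightarrow> free_of x (f i)) \<Longrightarrow> free_of x (\<Sum>i\<in>A. f i)"
  using free_of_pconst[of x 0]
  by (induction A rule: infinite_finite_induct) (auto intro: free_of_add)

lemmas free_of_intros = free_of_add free_of_diff free_of_mult free_of_pvar free_of_power

text \<open>The remainder of \<open>f\<close> on division by \<open>x\<^sup>2 - p\<close>: a monomial \<open>x\<^bsup>2k+e\<^esup> m\<close> with \<open>e \<le> 1\<close> becomes \<open>p\<^sup>k x\<^sup>e m\<close>. When
  \<open>p\<close> is free of \<open>x\<close>, this is the coordinate map that exhibits the quotient ring as a free module with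
  basis \<open>1, x\<close> over the polynomials free of \<open>x\<close>.\<close>

definition quad_red :: "'n \<Rightarrow> 'n cpoly \<Rightarrow> 'n cpoly \<Rightarrow> 'n cpoly" where
  "quad_red x p f = (\<Sum>m\<in>Poly_Mapping.keys f. pconst (Poly_Mapping.lookup f m) *
     (p ^ (Poly_Mapping.lookup m x div 2) *
      Poly_Mapping.single (Poly_Mapping.update x (Poly_Mapping.lookup m x mod 2) m) 1))"

lemma quad_red_add: "quad_red x p (f + g) = quad_red x p f + quad_red x p g"
  unfolding quad_red_def by (rule sum_keys_add) (simp_all add: pconst_add distrib_right)
lemma quad_red_0 [simp]: "quad_red x p 0 = 0" by (simp add: quad_red_def)
lemma quad_red_diff: "quad_red x p (f - g) = quad_red x p f - quad_red x p g"
  using quad_red_add[of x p "f - g" g] by simp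
lemma quad_red_sum: "quad_red x p (\<Sum>i\<in>A. f i) = (\<Sum>i\<in>A. quad_red x p (f i))"
  by (induction A rule: infinite_finite_induct) (auto simp: quad_red_add)
lemma quad_red_single:
  "quad_red x p (Poly_Mapping.single m c) = pconst c * (p ^ (Poly_Mapping.lookup m x div 2) *
      Poly_Mapping.single (Poly_Mapping.update x (Poly_Mapping.lookup m x mod 2) m) 1)"
  unfolding quad_red_def
  by (rule sum_keys_single[of "\<lambda>m c. pconst c * (p ^ (Poly_Mapping.lookup m x div 2) *
      Poly_Mapping.single (Poly_Mapping.update x (Poly_Mapping.lookup m x mod 2) m) 1)"]) simp

lemma quad_red_mult_single:
  assumes "Poly_Mapping.lookup m x = 0"
  shows "quad_red x p (Poly_Mapping.single m c * g) = Poly_Mapping.single m c * quad_red x p g"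
proof (induction g rule: poly_induct)
  case (single n d)
  have upd: "Poly_Mapping.update x k (m + n) = m + Poly_Mapping.update x k n" for k
    using assms by (intro poly_mapping_eqI) (auto simp: lookup_update lookup_add)
  have split: "Poly_Mapping.single (m + Poly_Mapping.update x k n) (1::complex)
      = Poly_Mapping.single m 1 * Poly_Mapping.single (Poly_Mapping.update x k n) 1" for k
    by (simp add: mult_single)
  have "quad_red x p (Poly_Mapping.single m c * Poly_Mapping.single n d)
      = (pconst c * Poly_Mapping.single m 1) * quad_red x p (Poly_Mapping.single n d)"
    unfolding mult_single quad_red_single lookup_add assms upd pconst_mult
    by (simp add: split mult_ac)
  then show ?case by (simp only: flip: single_conv_pconst)
next
  case (add f g)
  then show ?case by (simp add: distrib_left quad_red_add)
qed

lemma quad_red_mult_free: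
  assumes "free_of x h"
  shows "quad_red x p (h * g) = h * quad_red x p g"
proof -
  have "quad_red x p ((\<Sum>m\<in>Poly_Mapping.keys h. Poly_Mapping.single m (Poly_Mapping.lookup h m)) * g)
     = (\<Sum>m\<in>Poly_Mapping.keys h. Poly_Mapping.single m (Poly_Mapping.lookup h m)) * quad_red x p g"
    using assms
    by (auto simp: sum_distrib_right quad_red_sum quad_red_mult_single free_of_def intro!: sum.cong)
  then show ?thesis by (simp only: sum_singles)
qed

lemma pvar_power: "pvar x ^ k = Poly_Mapping.single (Poly_Mapping.single x k) 1"
  by (induction k) (simp_all add: pvar_def mult_single single_add[symmetric])

lemma quad_red_mult_square: "quad_red x p (pvar x ^ 2 * g) = p * quad_red x p g"
proof (induction g rule: poly_induct)
  case (single n d)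
  have "Poly_Mapping.update x k (n + Poly_Mapping.single x 2) = Poly_Mapping.update x k n" for k
    by (intro poly_mapping_eqI) (auto simp: lookup_update lookup_add lookup_single when_def)
  then show ?case
    by (simp add: pvar_power mult_single quad_red_single lookup_add mult_ac)
next
  case (add f g)
  then show ?case by (simp add: distrib_left quad_red_add)
qed

lemma quad_red_mult_quad:
  "free_of x p \<Longrightarrow> quad_red x p ((pvar x ^ 2 - p) * g) = 0"
  by (simp add: left_diff_distrib quad_red_diff quad_red_mult_square quad_red_mult_free)

text \<open>For a monomial this is the divisibility of \<open>(x\<^sup>2)\<^sup>k - p\<^sup>k\<close> by \<open>x\<^sup>2 - p\<close>.\<close>

lemma quad_red_cong: "f - quad_red x p f \<in> ideal.span {pvar x ^ 2 - p}"
proof (induction f rule: poly_induct)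
  case (single n d)
  let ?k = "Poly_Mapping.lookup n x div 2"
  let ?r = "Poly_Mapping.single (Poly_Mapping.update x (Poly_Mapping.lookup n x mod 2) n) (1::complex)"
  have n: "Poly_Mapping.single x (2 * ?k) + Poly_Mapping.update x (Poly_Mapping.lookup n x mod 2) n = n"
    by (intro poly_mapping_eqI) (auto simp: lookup_update lookup_add lookup_single when_def)
  have "(pvar x ^ 2) ^ ?k = Poly_Mapping.single (Poly_Mapping.single x (2 * ?k)) (1::complex)"
    using pvar_power[of x "2 * ?k"] by (simp only: power_mult)
  then have e: "pconst d * ((pvar x ^ 2) ^ ?k * ?r) = Poly_Mapping.single n d"
    by (simp add: pconst_def mult_single n)
  have "Poly_Mapping.single n d - quad_red x p (Poly_Mapping.single n d)
      = pconst d * ((pvar x ^ 2) ^ ?k * ?r) - pconst d * (p ^ ?k * ?r)"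
    by (simp only: quad_red_single e)
  also have "\<dots> = (pconst d * ?r) * ((pvar x ^ 2) ^ ?k - p ^ ?k)"
    by (simp add: algebra_simps)
  also have "\<dots> = (pconst d * ?r * (\<Sum>i<?k. p ^ (?k - Suc i) * (pvar x ^ 2) ^ i)) * (pvar x ^ 2 - p)"
    by (simp add: power_diff_sumr2[of "pvar x ^ 2"] algebra_simps)
  finally show ?case by (simp add: ideal.span_scale ideal.span_base)
next
  case (add f g)
  then show ?case
    using ideal.span_add[OF add] by (simp add: quad_red_add algebra_simps)
qed

lemma mem_span_of_quad_red_zero:
  "quad_red x p f = 0 \<Longrightarrow> f \<in> ideal.span {pvar x ^ 2 - p}"
  using quad_red_cong[of f x p] by simp

text \<open>Taking remainders turns membership of \<open>g * h\<close> in the ideal into \<open>h * quad_red x p g = 0\<close>, an equation in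
  a domain.\<close>

lemma regular_mod_one_quadric:
  fixes h :: "('n::linorder) cpoly"
  assumes "free_of x p" "free_of x h" "h \<noteq> 0"
    and "g * h \<in> ideal.span {pvar x ^ 2 - p}"
  shows "g \<in> ideal.span {pvar x ^ 2 - p}"
proof -
  obtain s where "g * h = s * (pvar x ^ 2 - p)"
    using assms(4) by (auto simp: ideal.span_singleton)
  then have "h * g = (pvar x ^ 2 - p) * s" by (simp add: mult.commute)
  then have "h * quad_red x p g = 0"
    using assms by (metis quad_red_mult_free quad_red_mult_quad)
  with assms(3) show ?thesis by (simp add: mem_span_of_quad_red_zero)
qed

text \<open>The two remainder maps are applied one after the other. The first one removes the first quadric and is
  linear over the second one, because the second quadric is free of \<open>x\<close>.\<close>

lemma regular_mod_two_quadrics: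
  fixes h :: "('n::linorder) cpoly"
  assumes "free_of x p" "free_of y q" "free_of x (pvar y ^ 2 - q)" "free_of x h" "free_of y h" "h \<noteq> 0"
    and "g * h \<in> ideal.span {pvar x ^ 2 - p, pvar y ^ 2 - q}"
  shows "g \<in> ideal.span {pvar x ^ 2 - p, pvar y ^ 2 - q}"
proof -
  let ?P = "pvar x ^ 2 - p" and ?Q = "pvar y ^ 2 - q"
  obtain s t where "g * h - s * ?P = t * ?Q"
    using assms(7) by (auto simp: ideal.span_insert ideal.span_singleton)
  then have "h * g = ?P * s + ?Q * t" by (simp add: algebra_simps)
  then have "h * quad_red x p g = ?Q * quad_red x p t"
    using assms by (metis quad_red_mult_free quad_red_mult_quad quad_red_add add_0)
  then have "h * quad_red y q (quad_red x p g) = 0"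
    using assms by (metis quad_red_mult_free quad_red_mult_quad)
  with assms(6) have "quad_red x p g \<in> ideal.span {?Q}"
    by (simp add: mem_span_of_quad_red_zero)
  then have "quad_red x p g \<in> ideal.span {?P, ?Q}"
    using ideal.span_mono[of "{?Q}" "{?P, ?Q}"] by auto
  moreover have "g - quad_red x p g \<in> ideal.span {?P, ?Q}"
    using quad_red_cong[of g x p] ideal.span_mono[of "{?P}" "{?P, ?Q}"] by auto
  ultimately show ?thesis
    using ideal.span_add by fastforce
qed

section \<open>Tangent cones through approximate parametrizations\<close>

lemma psubst_psubst: "psubst t (psubst s p) = psubst (\<lambda>i. psubst t (s i)) p"
  unfolding psubst_def[of s p]
  unfolding psubst_def[of "\<lambda>i. psubst t (s i)" p]
  by (simp add: psubst_sum psubst_mult psubst_prod psubst_power)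

lemma prod_pvar_power:
  fixes m :: "'n::finite \<Rightarrow>\<^sub>0 nat"
  shows "(\<Prod>i\<in>UNIV. pvar i ^ Poly_Mapping.lookup m i) = Poly_Mapping.single m 1"
proof -
  have "(\<Prod>i\<in>A. pvar i ^ k i) = Poly_Mapping.single (\<Sum>i\<in>A. Poly_Mapping.single i (k i)) 1"
    if "finite A" for A :: "'n set" and k
    using that by induction (simp_all add: pvar_power mult_single)
  moreover have "(\<Sum>i\<in>UNIV. Poly_Mapping.single i (Poly_Mapping.lookup m i)) = m"
    by (intro poly_mapping_eqI) (simp add: lookup_sum lookup_single when_def)
  ultimately show ?thesis by simp
qed

lemma psubst_id: "psubst pvar p = p"
  by (simp add: psubst_def prod_pvar_power sum_singles flip: single_conv_pconst)

lemma span_mult_cong: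
  assumes "a - b \<in> ideal.span I" "c - d \<in> ideal.span I"
  shows "a * c - b * d \<in> ideal.span I"
proof -
  have "a * c - b * d = c * (a - b) + b * (c - d)" by (simp add: algebra_simps)
  then show ?thesis using assms by (simp add: ideal.span_add ideal.span_scale)
qed

lemma psubst_cong_mod:
  assumes "\<And>i. s i - t i \<in> ideal.span I"
  shows "psubst s p - psubst t p \<in> ideal.span I"
proof -
  have pow: "s i ^ k - t i ^ k \<in> ideal.span I" for i k
    by (induction k) (auto intro: span_mult_cong assms ideal.span_zero)
  have prod: "(\<Prod>i\<in>A. s i ^ k i) - (\<Prod>i\<in>A. t i ^ k i) \<in> ideal.span I" for A k
    by (induction A rule: infinite_finite_induct) (auto intro: span_mult_cong pow ideal.span_zero)
  show ?thesis
    by (auto simp: psubst_def sum_subtractf[symmetric] right_diff_distrib[symmetric]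
        intro!: ideal.span_sum ideal.span_scale prod)
qed

lemma psubst_span:
  assumes "f \<in> ideal.span G"
  shows "psubst s f \<in> ideal.span (psubst s ` G)"
  using assms
proof (induction rule: ideal.span_induct_alt)
  case base
  then show ?case by (simp add: ideal.span_zero)
next
  case (step c g f)
  have "psubst s g \<in> ideal.span (psubst s ` G)"
    using step by (intro ideal.span_base) simp
  then show ?case
    using step by (simp add: psubst_add psubst_mult ideal.span_add ideal.span_scale)
qed

text \<open>The polynomials \<open>a\<close> and \<open>b\<close> vanish to order \<open>k\<close> and have the same component of degree \<open>k\<close>.\<close>

definition tangent_to :: "nat \<Rightarrow> ('n::finite) cpoly \<Rightarrow> 'n cpoly \<Rightarrow> bool" where
  "tangent_to k a b \<longleftrightarrow> ord_ge k a \<and> ord_ge k b \<and> ord_ge (Suc k) (a - b)"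

lemma tangent_to_mono: "tangent_to n a b \<Longrightarrow> k \<le> n \<Longrightarrow> tangent_to k a b"
  by (auto simp: tangent_to_def intro: ord_ge_mono)

lemma tangent_to_one: "tangent_to 0 1 1"
  by (simp add: tangent_to_def)

lemma tangent_to_mult:
  assumes "tangent_to k a b" "tangent_to l c d"
  shows "tangent_to (k + l) (a * c) (b * d)"
proof -
  have "a * c - b * d = (a - b) * c + b * (c - d)" by (simp add: algebra_simps)
  moreover have "ord_ge (Suc (k + l)) ((a - b) * c)" "ord_ge (Suc (k + l)) (b * (c - d))"
    using assms ord_ge_mult[of "Suc k" "a - b" l c] ord_ge_mult[of k b "Suc l" "c - d"]
    by (auto simp: tangent_to_def)
  ultimately show ?thesis
    using assms by (auto simp: tangent_to_def ord_ge_add intro: ord_ge_mult)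
qed

lemma tangent_to_psubst:
  assumes lin: "\<And>i. tangent_to 1 (s i) (t i)" and "ord_ge n p"
  shows "tangent_to n (psubst s p) (psubst t p)"
proof -
  have pow: "tangent_to k (s i ^ k) (t i ^ k)" for i k
  proof (induction k)
    case (Suc k)
    show ?case using tangent_to_mult[OF lin[of i] Suc] by simp
  qed (simp add: tangent_to_one)
  have "tangent_to (\<Sum>i\<in>A. k i) (\<Prod>i\<in>A. s i ^ k i) (\<Prod>i\<in>A. t i ^ k i)" for A k
    by (induction A rule: infinite_finite_induct) (auto intro: tangent_to_mult pow tangent_to_one)
  then have "tangent_to (mon_degree m) (\<Prod>i\<in>UNIV. s i ^ Poly_Mapping.lookup m i) (\<Prod>i\<in>UNIV. t i ^ Poly_Mapping.lookup m i)" for m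
    by (simp add: mon_degree_def)
  then have "tangent_to n (\<Prod>i\<in>UNIV. s i ^ Poly_Mapping.lookup m i) (\<Prod>i\<in>UNIV. t i ^ Poly_Mapping.lookup m i)"
    if "m \<in> Poly_Mapping.keys p" for m
    using that assms(2) tangent_to_mono unfolding ord_ge_def by blast
  then show ?thesis
    unfolding tangent_to_def psubst_def
    by (auto simp: sum_subtractf[symmetric] right_diff_distrib[symmetric] intro!: ord_ge_sum ord_ge_mult_left)
qed

lemma homogeneous_psubst:
  assumes lin: "\<And>i. homogeneous 1 (t i)" and "homogeneous d p"
  shows "homogeneous d (psubst t p)"
proof -
  have "homogeneous (\<Sum>i\<in>A. k i) (\<Prod>i\<in>A. t i ^ k i)" for A k
    using homogeneous_pconst[of 1] homogeneous_power[OF lin]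
    by (induction A rule: infinite_finite_induct) (auto intro: homogeneous_mult)
  then have "homogeneous (mon_degree m) (\<Prod>i\<in>UNIV. t i ^ Poly_Mapping.lookup m i)" for m
    by (simp add: mon_degree_def)
  then show ?thesis
    using assms(2) unfolding psubst_def homogeneous_def[of d p]
    by (intro homogeneous_sum homogeneous_pconst_mult) metis
qed

text \<open>Think of \<open>s\<close> as a parametrization, up to order \<open>N\<close>, of a smooth variety through the origin with
  tangent space parametrized by the linear map \<open>t\<close>; modulo its equations every element of \<open>G\<close> is a multiple of
  \<open>F\<close>. If \<open>f\<close> has initial degree \<open>d\<close>, its pullback along \<open>s\<close> agrees in degree \<open>d\<close> with the pullback of the
  initial form along \<open>t\<close>. On the other hand it is a multiple of the form \<open>F\<close> up to order \<open>d + 1\<close>, so its component of degree \<open>d\<close>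
  is a multiple of \<open>F\<close> as well. Approximation to finite order makes power series unnecessary.\<close>

lemma initial_form_pullback_in_span:
  fixes F :: "('k::finite) cpoly" and t :: "'n::finite \<Rightarrow> 'k cpoly"
  assumes F: "homogeneous e F" and t: "\<And>i. homogeneous 1 (t i)"
    and arc: "\<And>N. \<exists>s. (\<forall>i. ord_ge 2 (s i - t i)) \<and>
      (\<forall>g\<in>G. \<exists>w. ord_ge N (psubst s g - w * F))"
    and f: "f \<in> ideal.span G"
  shows "psubst t (initial_form f) \<in> ideal.span {F}"
proof -
  obtain d where d: "homogeneous d (initial_form f)" "ord_ge (Suc d) (f - initial_form f)"
    by (rule initial_form_decomp)
  obtain s where s: "\<And>i. ord_ge 2 (s i - t i)"
    and sG: "\<And>g. g \<in> G \<Longrightarrow> \<exists>w. ord_ge (Suc d) (psubst s g - w * F)"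
    using arc by meson
  have "\<exists>w. ord_ge (Suc d) (psubst s f - w * F)"
    using f
  proof (induction rule: ideal.span_induct_alt)
    case base
    then show ?case by (auto intro!: exI[of _ 0])
  next
    case (step c g f)
    obtain w w' where w: "ord_ge (Suc d) (psubst s g - w * F)" "ord_ge (Suc d) (psubst s f - w' * F)"
      using step sG by blast
    have "psubst s (c * g + f) - (psubst s c * w + w') * F
        = psubst s c * (psubst s g - w * F) + (psubst s f - w' * F)"
      by (simp add: psubst_add psubst_mult algebra_simps)
    then show ?case
      using w by (metis ord_ge_add ord_ge_mult_left)
  qed
  then obtain w where w: "ord_ge (Suc d) (psubst s f - w * F)" by blast
  have tan: "tangent_to 1 (s i) (t i)" for i
  proof -
    have "ord_ge 1 (t i)" using t homogeneous_ord_ge by blast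
    moreover have "ord_ge 1 ((s i - t i) + t i)"
      using calculation s[of i] by (intro ord_ge_add) (auto intro: ord_ge_mono)
    ultimately show ?thesis using s[of i] by (simp add: tangent_to_def numeral_2_eq_2)
  qed
  \<comment> \<open>Modulo order \<open>d + 1\<close>, the pullback of \<open>f\<close> along \<open>s\<close> is that of its initial form along \<open>t\<close>.\<close>
  let ?H = "psubst t (initial_form f)"
  have "ord_ge (Suc d) (psubst s (f - initial_form f))"
    using tangent_to_psubst[OF tan d(2)] by (simp add: tangent_to_def)
  moreover have "ord_ge (Suc d) (psubst s (initial_form f) - ?H)"
    using tangent_to_psubst[OF tan homogeneous_ord_ge[OF d(1)]] by (simp add: tangent_to_def)
  ultimately have "ord_ge (Suc d) (psubst s f - ?H)"
    using ord_ge_add by (fastforce simp: psubst_diff)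
  then have "ord_ge (Suc d) (?H - w * F)"
    using ord_ge_diff[OF w, of "psubst s f - ?H"] by simp
  then have "hom_part d (?H - w * F) = 0" by (simp add: hom_part_ord_ge)
  then have "?H = hom_part d (w * F)"
    using homogeneous_psubst[OF t d(1)] by (simp add: hom_part_diff hom_part_homogeneous[of d])
  then show ?thesis using hom_part_mult_in_span[OF F] by simp
qed

text \<open>The implicit function \<open>\<phi>\<close> with \<open>c \<phi> + \<phi>\<^sup>2 + r = 0\<close> and \<open>\<phi>(0) = 0\<close>, approximated by polynomials. It is found
  by Newton's iteration with the derivative kept at its value \<open>c\<close> at the origin, which raises the order
  of the error in each step because \<open>\<phi>\<close> itself vanishes at the origin.\<close>

lemma approximate_root:
  assumes "c \<noteq> 0" "ord_ge 2 r"
  shows "\<exists>\<phi>. ord_ge 2 \<phi> \<and> ord_ge N (pconst c * \<phi> + \<phi> ^ 2 + r)"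
proof (induction N)
  case 0
  then show ?case by (auto intro: exI[of _ 0])
next
  case (Suc N)
  then obtain \<phi> where phi: "ord_ge 2 \<phi>" and e: "ord_ge N (pconst c * \<phi> + \<phi> ^ 2 + r)" (is "ord_ge N ?e") by blast
  \<comment> \<open>The new error is \<open>\<delta> * (\<delta> - 2 * \<phi>)\<close>, two orders better than \<open>\<delta>\<close>.\<close>
  define \<delta> where "\<delta> = pconst (1 / c) * ?e"
  have c: "pconst c * \<delta> = ?e"
    using assms(1) by (simp add: \<delta>_def mult.assoc[symmetric] pconst_mult[symmetric])
  have "ord_ge 2 ?e"
    using phi assms(2) by (auto simp: power2_eq_square intro!: ord_ge_add ord_ge_mult_left)
  then have \<delta>: "ord_ge 2 \<delta>" "ord_ge N \<delta>"
    using e by (auto simp: \<delta>_def intro: ord_ge_mult_left)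
  have "pconst c * (\<phi> - \<delta>) + (\<phi> - \<delta>) ^ 2 + r = \<delta> * (\<delta> - (\<phi> + \<phi>))"
    using c by (simp add: algebra_simps power2_eq_square)
  moreover have "ord_ge (N + 2) (\<delta> * (\<delta> - (\<phi> + \<phi>)))"
    using phi \<delta> by (intro ord_ge_mult ord_ge_diff ord_ge_add)
  ultimately have "ord_ge (Suc N) (pconst c * (\<phi> - \<delta>) + (\<phi> - \<delta>) ^ 2 + r)"
    by (auto intro: ord_ge_mono)
  then show ?case using phi \<delta> by (blast intro: ord_ge_diff)
qed

section \<open>Diagonal quadrics on the Fermat cubic surface\<close>

text \<open>If all the nonzero \<open>w i\<close> are nonnegative real multiples of one complex number \<open>t\<close>, the equation says that a
  sum of nonnegative cubes is zero.\<close>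

lemma critical_values_real_pencil_zero:
  fixes r :: "'i \<Rightarrow> real" and w :: "'i \<Rightarrow> complex"
  assumes "finite I" "t \<noteq> 0" and r: "\<And>i. i \<in> I \<Longrightarrow> r i \<ge> 0"
    and w: "\<And>i. i \<in> I \<Longrightarrow> w i = 0 \<or> w i = t * of_real (r i)"
    and s: "(\<Sum>i\<in>I. t * of_real (r i) * w i ^ 2) = 0"
    and "i \<in> I"
  shows "w i = 0"
proof -
  define \<rho> where "\<rho> j = (if w j = 0 then 0 else r j)" for j
  have "t * of_real (r j) * w j ^ 2 = t ^ 3 * of_real (\<rho> j ^ 3)" if "j \<in> I" for j
    using w[OF that] by (auto simp: \<rho>_def power2_eq_square power3_eq_cube)
  then have "t ^ 3 * of_real (\<Sum>j\<in>I. \<rho> j ^ 3) = 0"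
    using s by (simp add: sum_distrib_left del: of_real_power)
  then have "(\<Sum>j\<in>I. \<rho> j ^ 3) = 0"
    using assms(2) by (simp only: mult_eq_0_iff power_eq_0_iff of_real_eq_0_iff simp_thms)
  moreover have "\<rho> j ^ 3 \<ge> 0" if "j \<in> I" for j using r[OF that] by (simp add: \<rho>_def)
  ultimately have "\<rho> i ^ 3 = 0" using assms(1,6) by (simp add: sum_nonneg_eq_0_iff)
  then show ?thesis using w[OF assms(6)] by (auto simp: \<rho>_def split: if_splits)
qed

text \<open>Write \<open>w i = R i + \<i> S i\<close>. For each \<open>i\<close> the imaginary part \<open>S i\<close> is \<open>Im z\<close> or \<open>w i\<close> is zero, so the imaginary
  parts of the two equations say that \<open>Im z\<close> annihilates both \<open>\<Sum> R i\<close> and \<open>\<Sum> \<alpha> i * R i\<close>. As \<open>(R i)\<^sup>2 = R i * (Re z + \<alpha> i)\<close>, it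
  also annihilates \<open>\<Sum> (R i)\<^sup>2\<close>. So all \<open>R i\<close> or all \<open>S i\<close> are zero, and the real part of the first equation,
  \<open>\<Sum> (R i)\<^sup>2 = \<Sum> (S i)\<^sup>2\<close>, gives the other half.\<close>

lemma critical_values_base_locus_zero:
  fixes \<alpha> :: "'i \<Rightarrow> real" and w :: "'i \<Rightarrow> complex"
  assumes "finite I"
    and w: "\<And>i. i \<in> I \<Longrightarrow> w i = 0 \<or> w i = of_real (\<alpha> i) + z"
    and s1: "(\<Sum>i\<in>I. w i ^ 2) = 0" and s2: "(\<Sum>i\<in>I. of_real (\<alpha> i) * w i ^ 2) = 0"
    and "i \<in> I"
  shows "w i = 0"
proof -
  let ?R = "\<lambda>i. Re (w i)" and ?S = "\<lambda>i. Im (w i)"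
  have rs: "?R j * ?S j = Im z * ?R j" and rr: "?R j ^ 2 = ?R j * (Re z + \<alpha> j)" if "j \<in> I" for j
    using w[OF that] by (auto simp: power2_eq_square)
  have "(\<Sum>j\<in>I. ?R j ^ 2 - ?S j ^ 2) = 0" using arg_cong[OF s1, of Re] by (simp add: Re_power2)
  then have eq: "(\<Sum>j\<in>I. ?R j ^ 2) = (\<Sum>j\<in>I. ?S j ^ 2)" by (simp add: sum_subtractf)
  have "(\<Sum>j\<in>I. 2 * (?R j * ?S j)) = 0" using arg_cong[OF s1, of Im] by (simp add: Im_power2 mult_ac)
  then have i1: "(\<Sum>j\<in>I. Im z * ?R j) = 0"
    using rs by (simp flip: sum_distrib_left)
  have "(\<Sum>j\<in>I. 2 * (\<alpha> j * (?R j * ?S j))) = 0"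
    using arg_cong[OF s2, of Im] by (simp add: Im_power2 mult_ac)
  then have i2: "(\<Sum>j\<in>I. \<alpha> j * (Im z * ?R j)) = 0"
    using rs by (simp flip: sum_distrib_left)
  have "Im z * (\<Sum>j\<in>I. ?R j ^ 2) = (\<Sum>j\<in>I. Re z * (Im z * ?R j) + \<alpha> j * (Im z * ?R j))"
    unfolding sum_distrib_left by (intro sum.cong) (auto simp: rr algebra_simps)
  also have "\<dots> = 0" using i1 i2 by (simp add: sum.distrib flip: sum_distrib_left)
  finally consider "Im z = 0" | "(\<Sum>j\<in>I. ?R j ^ 2) = 0" by auto
  then have "(\<Sum>j\<in>I. ?S j ^ 2) = 0"
  proof cases
    case 1
    then have "?S j = 0" if "j \<in> I" for j using w[OF that] by auto
    then show ?thesis by simp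
  next
    case 2
    then show ?thesis using eq by simp
  qed
  with eq have "?R i ^ 2 = 0" "?S i ^ 2 = 0"
    using assms(1,5) by (simp_all add: sum_nonneg_eq_0_iff)
  then show ?thesis by (simp add: complex_eq_iff)
qed

text \<open>The hypotheses on \<open>l, m, n\<close> state that the gradients of the three equations are linearly dependent at the
  point with coordinates \<open>a, b, c, u\<close>. For \<open>n \<noteq> 0\<close> they make a rescaling of each \<open>u i\<close> equal to \<open>0\<close> or
  \<open>l * \<alpha> i + m\<close>. If \<open>l\<close>, \<open>m\<close> and \<open>l + m\<close> are nonzero, then
  \<open>a = b = c = 0\<close> and both quadrics give equations in \<open>u\<close> alone; otherwise \<open>l : m\<close> is one of \<open>0 : 1\<close>, \<open>1 : 0\<close>, \<open>1 : -1\<close>. The bound \<open>\<alpha> i \<ge> 1\<close> makes \<open>l * \<alpha> i + m\<close> a nonnegative real multiple of a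
  constant in each of these three cases.\<close>

lemma fermat_pencil_no_singularity:
  fixes \<alpha> :: "'i \<Rightarrow> real" and u :: "'i \<Rightarrow> complex"
  assumes I: "finite I" and inj: "inj_on \<alpha> I" and \<alpha>: "\<And>i. i \<in> I \<Longrightarrow> \<alpha> i \<ge> 1"
    and nz: "l \<noteq> 0 \<or> m \<noteq> 0 \<or> n \<noteq> 0"
    and abc: "l * a = 0" "m * b = 0" "(l + m) * c = 0"
    and u: "\<And>i. i \<in> I \<Longrightarrow> 2 * (l * of_real (\<alpha> i) + m) * u i + 3 * n * u i ^ 2 = 0"
    and q1: "a ^ 2 - c ^ 2 + (\<Sum>i\<in>I. of_real (\<alpha> i) * u i ^ 2) = 0"
    and q2: "b ^ 2 - c ^ 2 + (\<Sum>i\<in>I. u i ^ 2) = 0"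
    and q3: "(\<Sum>i\<in>I. u i ^ 3) = 0"
    and i: "i \<in> I"
  shows "u i = 0"
proof -
  let ?g = "\<lambda>j. l * of_real (\<alpha> j) + m"
  consider "l = 0" "m = 0" "n \<noteq> 0" | "l \<noteq> 0 \<or> m \<noteq> 0" "n = 0" | "l \<noteq> 0 \<or> m \<noteq> 0" "n \<noteq> 0"
    using nz by blast
  then show ?thesis
  proof cases
    case 1
    then show ?thesis using u[OF i] by simp
  next
    case 2
    \<comment> \<open>The weights are distinct, so at most one coordinate can be nonzero, and the cubic excludes that.\<close>
    have g: "?g j = 0" if "j \<in> I" "u j \<noteq> 0" for j
    proof -
      have "2 * ?g j * u j = 0"
        using u[OF that(1)] unfolding 2(2) by (simp only: mult_zero_right mult_zero_left add_0_right)
      then show ?thesis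
        using that(2) by (metis mult_eq_0_iff zero_neq_numeral)
    qed
    show ?thesis
    proof (rule ccontr)
      assume ui: "u i \<noteq> 0"
      then have gi: "?g i = 0" using g i by blast
      have "u j = 0" if j: "j \<in> I" "j \<noteq> i" for j
      proof (rule ccontr)
        assume "u j \<noteq> 0"
        then have gj: "?g j = 0" using g j by blast
        have "l * (of_real (\<alpha> j) - of_real (\<alpha> i)) = ?g j - ?g i" by (simp add: algebra_simps)
        also have "\<dots> = 0" unfolding gi gj by simp
        finally have "l * (of_real (\<alpha> j) - of_real (\<alpha> i)) = 0" .
        moreover have "\<alpha> j \<noteq> \<alpha> i" using inj j i by (auto simp: inj_on_def)
        ultimately have "l = 0" by simp
        then show False using gi 2 by simp
      qed
      then have "(\<Sum>j\<in>I. u j ^ 3) = (\<Sum>j\<in>I. if j = i then u i ^ 3 else 0)"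
        by (intro sum.cong) auto
      then show False using q3 ui i I by simp
    qed
  next
    case 3
    \<comment> \<open>The scaling that turns the equation for \<open>u j\<close> into \<open>w j * (w j - ?g j) = 0\<close>.\<close>
    define k where "k = - (3 * n / 2)"
    define w where "w j = k * u j" for j
    have k: "k \<noteq> 0" using 3 by (simp add: k_def)
    have w: "w j = 0 \<or> w j = ?g j" if "j \<in> I" for j
    proof -
      have "w j * (w j - ?g j) = - (k / 2) * (2 * ?g j * u j + 3 * n * u j ^ 2)"
        by (simp add: w_def k_def power2_eq_square field_simps)
      then show ?thesis using u[OF that] by simp
    qed
    \<comment> \<open>In the combination of the two quadrics with coefficients \<open>l, m\<close> the terms in \<open>a, b, c\<close> drop out.\<close>
    have "l * a ^ 2 = 0" "m * b ^ 2 = 0" "(l + m) * c ^ 2 = 0"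
      using abc by auto
    then have "l * (\<Sum>j\<in>I. of_real (\<alpha> j) * u j ^ 2) + m * (\<Sum>j\<in>I. u j ^ 2) = 0"
      using arg_cong[OF q1, of "(*) l"] arg_cong[OF q2, of "(*) m"] by (auto simp add: algebra_simps)
    then have "(\<Sum>j\<in>I. ?g j * u j ^ 2) = 0"
      by (simp add: distrib_right sum.distrib sum_distrib_left mult.assoc)
    then have "k ^ 2 * (\<Sum>j\<in>I. ?g j * u j ^ 2) = 0" by simp
    then have sg: "(\<Sum>j\<in>I. ?g j * w j ^ 2) = 0"
      by (simp add: sum_distrib_left w_def power_mult_distrib mult_ac)
    consider "l = 0" "m \<noteq> 0" | "l \<noteq> 0" "m = 0" | "l \<noteq> 0" "m = - l" | "l \<noteq> 0" "m \<noteq> 0" "l + m \<noteq> 0"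
      using 3 by (metis add.commute add_eq_0_iff)
    then have "w i = 0"
    proof cases
      case 1
      then show ?thesis
        using w sg by (intro critical_values_real_pencil_zero[OF I, of m "\<lambda>_. 1" w i]) (auto simp: i)
    next
      case 2
      then show ?thesis
        using w sg \<alpha> by (intro critical_values_real_pencil_zero[OF I, of l \<alpha> w i]) (force simp: i)+
    next
      case 3
      then show ?thesis
        using w sg \<alpha> by (intro critical_values_real_pencil_zero[OF I, of l "\<lambda>j. \<alpha> j - 1" w i])
          (auto simp: i algebra_simps)
    next
      case 4
      then have "a = 0" "b = 0" "c = 0" using abc by auto
      then have q: "(\<Sum>j\<in>I. of_real (\<alpha> j) * u j ^ 2) = 0" "(\<Sum>j\<in>I. u j ^ 2) = 0"
        using q1 q2 by auto
      have "(\<Sum>j\<in>I. of_real (\<alpha> j) * (w j / l) ^ 2) = (k / l) ^ 2 * (\<Sum>j\<in>I. of_real (\<alpha> j) * u j ^ 2)"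
        "(\<Sum>j\<in>I. (w j / l) ^ 2) = (k / l) ^ 2 * (\<Sum>j\<in>I. u j ^ 2)"
        unfolding sum_distrib_left
        by (auto intro!: sum.cong simp: w_def power_mult_distrib power_divide)
      then have "w i / l = 0"
        using w q 4 by (intro critical_values_base_locus_zero[OF I, of "\<lambda>j. w j / l" \<alpha> "m / l" i])
          (auto simp: i field_simps)
      then show ?thesis using 4 by simp
    qed
    then show ?thesis using k by (simp add: w_def)
  qed
qed

section \<open>Two quadrics and a cubic cone\<close>

lemma dim_less_3_dependence:
  fixes x y z :: "complex ^ 'n"
  assumes "vec.dim {x, y, z} < 3"
  obtains (dep) l m n where "l \<noteq> 0 \<or> m \<noteq> 0 \<or> n \<noteq> 0" "l *s x + m *s y + n *s z = 0"
proof (rule ccontr)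
  assume "\<not> thesis"
  then have rel: "l = 0 \<and> m = 0 \<and> n = 0" if "l *s x + m *s y + n *s z = 0" for l m n
    using that dep \<open>\<not> thesis\<close> by blast
  have z: "z \<notin> vec.span {}" using rel[of 0 0 1] by auto
  have y: "y \<notin> vec.span {z}" using rel[of 0 1 "- k" for k] by (auto simp: vec.span_singleton)
  have x: "x \<notin> vec.span {y, z}"
  proof
    assume "x \<in> vec.span {y, z}"
    then obtain k j where "x - k *s y = j *s z"
      by (auto simp: vec.span_insert vec.span_singleton)
    then have "1 *s x + (- k) *s y + (- j) *s z = 0" by (simp add: algebra_simps)
    then show False using rel[of 1 "- k" "- j"] by simp
  qed
  have "vec.independent {x, y, z}"
    using x y z by (simp add: vec.independent_insert vec.independent_empty)
  moreover have "card {x, y, z} = 3"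
    using x y vec.span_base by (auto simp: card_insert_if)
  ultimately show False using assms vec.dim_eq_card_independent by force
qed


text \<open>The last four homogeneous coordinates of \<open>P\<^sup>6\<close>, on which the cubic depends. The remaining indices
  \<open>0, 1, 2\<close> are the coordinates of the vertex plane.\<close>

definition cone_coord :: "4 \<Rightarrow> 7" where
  "cone_coord j = (if j = 1 then 3 else if j = 2 then 4 else if j = 3 then 5 else 6)"

text \<open>What matters is that the weights are distinct, real and at least \<open>1\<close>: the positivity arguments in
  \<open>fermat_pencil_no_singularity\<close> rely on it.\<close>

definition weight :: "4 \<Rightarrow> real" where
  "weight j = (if j = 1 then 1 else if j = 2 then 2 else if j = 3 then 3 else 4)"

lemma cone_coord_eq_iff [simp]: "cone_coord i = cone_coord j \<longleftrightarrow> i = j"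
proof -
  have "\<forall>i j. cone_coord i = cone_coord j \<longrightarrow> i = j"
    by (simp add: forall_4 cone_coord_def)
  then show ?thesis by blast
qed

lemma cone_coord_neq [simp]:
  "cone_coord j \<noteq> 0" "cone_coord j \<noteq> 1" "cone_coord j \<noteq> 2"
  "0 \<noteq> cone_coord j" "1 \<noteq> cone_coord j" "2 \<noteq> cone_coord j"
  by (auto simp: cone_coord_def)

lemma coord_cases:
  obtains "i = 0" | "i = 1" | "i = 2" | j where "i = cone_coord j"
proof -
  have "card {0, 1, 2, 3, 4, 5, 6::7} = card (UNIV :: 7 set)" by simp
  then have "{0, 1, 2, 3, 4, 5, 6::7} = UNIV" by (intro card_subset_eq) auto
  then have "i \<in> {0, 1, 2, 3, 4, 5, 6}" by simp
  moreover have "cone_coord 1 = 3" "cone_coord 2 = 4" "cone_coord 3 = 5" "cone_coord 4 = 6"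
    by (simp_all add: cone_coord_def)
  ultimately show ?thesis using that by (metis insertE empty_iff)
qed

lemma weight_inj: "inj weight"
proof -
  have "\<forall>i j. weight i = weight j \<longrightarrow> i = j"
    by (simp add: forall_4 weight_def)
  then show ?thesis by (simp add: inj_def)
qed

lemma weight_ge_1: "weight j \<ge> 1"
  by (simp add: weight_def)

definition cone_quadric :: "(4 \<Rightarrow> real) \<Rightarrow> 7 cpoly" where
  "cone_quadric \<alpha> = (\<Sum>j\<in>UNIV. pconst (of_real (\<alpha> j)) * pvar (cone_coord j) ^ 2)"

definition quadric :: "7 \<Rightarrow> (4 \<Rightarrow> real) \<Rightarrow> 7 cpoly" where
  "quadric k \<alpha> = pvar k ^ 2 - (pvar 0 ^ 2 - cone_quadric \<alpha>)"

definition fermat_cubic :: "4 cpoly" where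
  "fermat_cubic = (\<Sum>j\<in>UNIV. pvar j ^ 3)"

definition fermat_cone :: "7 cpoly" where
  "fermat_cone = (\<Sum>j\<in>UNIV. pvar (cone_coord j) ^ 3)"

abbreviation "example \<equiv> [quadric 1 weight, quadric 2 (\<lambda>_. 1), fermat_cone]"

lemma homogeneous_cone_quadric: "homogeneous 2 (cone_quadric \<alpha>)"
  unfolding cone_quadric_def
  by (intro homogeneous_sum homogeneous_pconst_mult homogeneous_pvar_power)
lemma homogeneous_quadric: "homogeneous 2 (quadric k \<alpha>)"
  unfolding quadric_def
  by (intro homogeneous_diff homogeneous_pvar_power homogeneous_cone_quadric)
lemma homogeneous_fermat_cone: "homogeneous 3 fermat_cone"
  unfolding fermat_cone_def by (intro homogeneous_sum homogeneous_pvar_power)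
lemma homogeneous_fermat_cubic: "homogeneous 3 fermat_cubic"
  unfolding fermat_cubic_def by (intro homogeneous_sum homogeneous_pvar_power)

lemma peval_quadric:
  "peval (quadric k \<alpha>) v = v $ k ^ 2 - v $ 0 ^ 2 + (\<Sum>j\<in>UNIV. of_real (\<alpha> j) * v $ cone_coord j ^ 2)"
  by (simp add: quadric_def cone_quadric_def peval_hom peval_sum)
lemma peval_fermat_cone: "peval fermat_cone v = (\<Sum>j\<in>UNIV. v $ cone_coord j ^ 3)"
  by (simp add: fermat_cone_def peval_hom peval_sum)
lemma peval_fermat_cubic: "peval fermat_cubic v = (\<Sum>j\<in>UNIV. v $ j ^ 3)"
  by (simp add: fermat_cubic_def peval_hom peval_sum)

lemma hypersurface_quadric: "k \<noteq> 0 \<Longrightarrow> (\<And>j. cone_coord j \<noteq> k) \<Longrightarrow> hypersurface_eq 2 (quadric k \<alpha>)"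
proof -
  assume "k \<noteq> 0" "\<And>j. cone_coord j \<noteq> k"
  then have "peval (quadric k \<alpha>) (axis k 1) = 1"
    by (simp add: peval_quadric axis_def)
  then show ?thesis by (auto simp: hypersurface_eq_def homogeneous_quadric)
qed

lemma fermat_cone_nz: "fermat_cone \<noteq> 0"
proof -
  have "peval fermat_cone (\<chi> i. 1) \<noteq> 0" by (simp add: peval_fermat_cone)
  then show ?thesis by auto
qed

lemma fermat_cubic_nz: "fermat_cubic \<noteq> 0"
proof -
  have "peval fermat_cubic (\<chi> i. 1) \<noteq> 0" by (simp add: peval_fermat_cubic)
  then show ?thesis by auto
qed

lemma singular_locus_fermat_cubic: "singular_locus [fermat_cubic] = {}"
proof -
  have "v = 0" if "grad fermat_cubic v = 0" for v :: "complex ^ 4"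
  proof -
    from that have "peval (pderiv_wrt i fermat_cubic) v = 0" for i
      by (simp add: grad_def vec_eq_iff)
    then have "(\<Sum>j\<in>UNIV. peval (pderiv_wrt i (pvar j ^ 3)) v) = 0" for i
      by (simp add: fermat_cubic_def pderiv_wrt_sum peval_sum)
    moreover have "peval (pderiv_wrt i (pvar j ^ 3)) v = (if i = j then 3 * v $ j ^ 2 else 0)" for i j
      by (auto simp: pderiv_wrt_rules peval_hom)
    ultimately have "(\<Sum>j\<in>UNIV. if i = j then 3 * v $ j ^ 2 else 0) = 0" for i
      by simp
    then show ?thesis by (simp add: vec_eq_iff)
  qed
  then have "grad fermat_cubic v \<noteq> 0" if "v \<noteq> 0" for v
    using that by blast
  then show ?thesis by (auto simp: singular_locus_def)
qed

text \<open>All three forms vanish at the origin, so the ideal is proper. Each quadric is monic in its own variable, \<open>1\<close>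
  or \<open>2\<close>, which does not occur in the other forms.\<close>

lemma complete_intersection_example: "complete_intersection example"
proof -
  let ?p = "\<lambda>\<alpha>. pvar 0 ^ 2 - cone_quadric \<alpha>"
  have free: "free_of k (?p \<alpha>)" "free_of k fermat_cone" if "k = 1 \<or> k = 2" for k \<alpha>
  proof -
    have "cone_coord j \<noteq> k" "0 \<noteq> k" for j using that by auto
    then show "free_of k (?p \<alpha>)" "free_of k fermat_cone"
      unfolding cone_quadric_def fermat_cone_def
      by (intro free_of_intros free_of_sum free_of_pconst; simp)+
  qed
  have "peval f 0 = 0" if "f \<in> ideal.span (set example)" for f
    using that
    by (induction rule: ideal.span_induct_alt)
      (auto simp: peval_hom peval_quadric peval_fermat_cone)
  then have proper: "1 \<notin> ideal.span (set example)" by fastforce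
  have "g \<in> ideal.span (set (take k example))"
    if k: "k < length example" and gk: "g * example ! k \<in> ideal.span (set (take k example))" for k g
  proof -
    consider "k = 0" | "k = 1" | "k = 2" using k by (auto simp: less_Suc_eq)
    then show ?thesis
    proof cases
      case 1
      then show ?thesis
        using gk hypersurface_quadric[of 1 weight] by (simp add: hypersurface_eq_def)
    next
      case 2
      then have "g * quadric 2 (\<lambda>_. 1) \<in> ideal.span {pvar 1 ^ 2 - ?p weight}"
        using gk by (simp add: quadric_def)
      moreover have "free_of 1 (quadric 2 (\<lambda>_. 1))"
        unfolding quadric_def by (intro free_of_diff free free_of_power free_of_pvar) simp_all
      ultimately have "g \<in> ideal.span {pvar 1 ^ 2 - ?p weight}"
        using regular_mod_one_quadric[of 1 "?p weight" "quadric 2 (\<lambda>_. 1)" g] hypersurface_quadric[of 2 "\<lambda>_. 1"] free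
        by (auto simp: hypersurface_eq_def)
      then show ?thesis using 2 by (simp add: quadric_def)
    next
      case 3
      have "free_of 1 (pvar 2 ^ 2 - ?p (\<lambda>_. 1))"
        by (intro free_of_diff free free_of_power free_of_pvar) simp_all
      moreover have "g * fermat_cone \<in> ideal.span {pvar 1 ^ 2 - ?p weight, pvar 2 ^ 2 - ?p (\<lambda>_. 1)}"
        using 3 gk by (simp add: quadric_def numeral_2_eq_2)
      ultimately show ?thesis
        using regular_mod_two_quadrics[of 1 "?p weight" 2 "?p (\<lambda>_. 1)" fermat_cone g] 3 free fermat_cone_nz
        by (simp add: quadric_def numeral_2_eq_2)
    qed
  qed
  then show ?thesis using proper unfolding complete_intersection_def by blast
qed

section \<open>The singular points\<close>

definition node :: "complex \<Rightarrow> complex \<Rightarrow> complex ^ 7" where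
  "node s t = (\<chi> i. if i = 0 then 1 else if i = 1 then s else if i = 2 then t else 0)"

lemma node_nth [simp]:
  "node s t $ 0 = 1" "node s t $ 1 = s" "node s t $ 2 = t" "node s t $ cone_coord j = 0"
  by (simp_all add: node_def)

lemma pderiv_quadric:
  "peval (pderiv_wrt i (quadric k \<alpha>)) v = (if i = k then 2 * v $ k else 0) - (if i = 0 then 2 * v $ 0 else 0)
    + (\<Sum>j\<in>UNIV. if i = cone_coord j then 2 * of_real (\<alpha> j) * v $ cone_coord j else 0)"
proof -
  have "peval (pderiv_wrt i (pconst (of_real (\<alpha> j)) * pvar (cone_coord j) ^ 2)) v
     = (if i = cone_coord j then 2 * of_real (\<alpha> j) * v $ cone_coord j else 0)" for j
    by (auto simp: pderiv_wrt_rules peval_hom)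
  moreover have "peval (pderiv_wrt i (pvar k ^ 2)) v = (if i = k then 2 * v $ k else 0)" for k
    by (auto simp: pderiv_wrt_rules peval_hom)
  ultimately show ?thesis
    by (simp add: quadric_def cone_quadric_def pderiv_wrt_add pderiv_wrt_diff pderiv_wrt_sum
        peval_add peval_diff peval_sum)
qed

lemma pderiv_fermat_cone:
  "peval (pderiv_wrt i fermat_cone) v = (\<Sum>j\<in>UNIV. if i = cone_coord j then 3 * v $ cone_coord j ^ 2 else 0)"
proof -
  have "peval (pderiv_wrt i (pvar (cone_coord j) ^ 3)) v = (if i = cone_coord j then 3 * v $ cone_coord j ^ 2 else 0)" for j
    by (auto simp: pderiv_wrt_rules peval_hom)
  then show ?thesis by (simp add: fermat_cone_def pderiv_wrt_sum peval_sum)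
qed

text \<open>The components of a linear relation between the three gradients are the hypotheses of
  \<open>fermat_pencil_no_singularity\<close>.\<close>

lemma singular_on_plane:
  assumes "\<forall>f\<in>set example. peval f v = 0" "vec.dim ((\<lambda>f. grad f v) ` set example) < 3"
  shows "v $ cone_coord j = 0"
proof -
  let ?q1 = "quadric 1 weight" and ?q2 = "quadric 2 (\<lambda>_. 1)"
  have "vec.dim {grad ?q1 v, grad ?q2 v, grad fermat_cone v} < 3"
    using assms(2) by simp
  then obtain l m n where nz: "l \<noteq> 0 \<or> m \<noteq> 0 \<or> n \<noteq> 0"
    and rel: "l *s grad ?q1 v + m *s grad ?q2 v + n *s grad fermat_cone v = 0"
    by (rule dim_less_3_dependence)
  have comp: "l * peval (pderiv_wrt i ?q1) v + m * peval (pderiv_wrt i ?q2) v + n * peval (pderiv_wrt i fermat_cone) v = 0" for i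
    using rel by (simp add: vec_eq_iff grad_def)
  show ?thesis
  proof (rule fermat_pencil_no_singularity[of UNIV weight l m n "v $ 1" "v $ 2" "v $ 0" "\<lambda>j. v $ cone_coord j" j])
    show "l * v $ 1 = 0" "m * v $ 2 = 0"
      using comp[of 1] comp[of 2] by (auto simp: pderiv_quadric pderiv_fermat_cone)
    show "(l + m) * v $ 0 = 0"
    proof -
      have "(l + m) * v $ 0 = - (1 / 2) * (l * (- (2 * v $ 0)) + m * (- (2 * v $ 0)))" by (simp add: algebra_simps)
      also have "\<dots> = 0" using comp[of 0] by (simp add: pderiv_quadric pderiv_fermat_cone)
      finally show ?thesis .
    qed
    show "2 * (l * of_real (weight i) + m) * v $ cone_coord i + 3 * n * v $ cone_coord i ^ 2 = 0" for i
      using comp[of "cone_coord i"] by (simp add: pderiv_quadric pderiv_fermat_cone algebra_simps)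
    show "v $ 1 ^ 2 - v $ 0 ^ 2 + (\<Sum>i\<in>UNIV. of_real (weight i) * v $ cone_coord i ^ 2) = 0"
      "v $ 2 ^ 2 - v $ 0 ^ 2 + (\<Sum>i\<in>UNIV. v $ cone_coord i ^ 2) = 0"
      "(\<Sum>i\<in>UNIV. v $ cone_coord i ^ 3) = 0"
      using assms(1) by (simp_all add: peval_quadric peval_fermat_cone)
  qed (use nz weight_inj weight_ge_1 in auto)
qed

text \<open>On the plane, where the gradient of the cubic is zero, every point of the threefold is singular, and the
  quadrics leave only \<open>y\<^sub>1\<^sup>2 = y\<^sub>0\<^sup>2 = y\<^sub>2\<^sup>2\<close>.\<close>

lemma singular_locus_example:
  "singular_locus example = (\<lambda>(s, t). vec.span {node s t}) ` ({1, -1} \<times> {1, -1})"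
proof (intro equalityI subsetI)
  fix P assume "P \<in> singular_locus example"
  then obtain v where P: "P = vec.span {v}" and nz: "v \<noteq> 0"
    and f: "\<forall>f\<in>set example. peval f v = 0" "vec.dim ((\<lambda>f. grad f v) ` set example) < 3"
    by (auto simp: singular_locus_def)
  have u: "v $ cone_coord j = 0" for j by (rule singular_on_plane[OF f])
  have sq: "v $ 1 ^ 2 = v $ 0 ^ 2" "v $ 2 ^ 2 = v $ 0 ^ 2"
    using f(1) by (simp_all add: peval_quadric u)
  have v0: "v $ 0 \<noteq> 0"
  proof
    assume "v $ 0 = 0"
    then have "v $ i = 0" for i using sq u by (cases i rule: coord_cases) auto
    then show False using nz by (simp add: vec_eq_iff)
  qed
  define s t where "s = v $ 1 / v $ 0" and "t = v $ 2 / v $ 0"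
  have "s ^ 2 = 1" "t ^ 2 = 1" using sq v0 by (simp_all add: s_def t_def power_divide)
  then have st: "(s, t) \<in> {1, -1} \<times> {1, -1}" by (auto simp: power2_eq_1_iff)
  have v: "v = v $ 0 *s node s t"
  proof -
    have "v $ i = (v $ 0 *s node s t) $ i" for i
      using v0 u by (cases i rule: coord_cases) (auto simp: s_def t_def)
    then show ?thesis unfolding vec_eq_iff by blast
  qed
  have "vec.span {v $ 0 *s node s t} = vec.span {node s t}"
    using v0 vec.span_image_scale[of "{node s t}" "\<lambda>_. v $ 0"] by simp
  then have "P = vec.span {node s t}" unfolding P by (simp only: v[symmetric])
  with st show "P \<in> (\<lambda>(s, t). vec.span {node s t}) ` ({1, -1} \<times> {1, -1})" by force
next
  fix P assume "P \<in> (\<lambda>(s, t). vec.span {node s t}) ` ({1, -1} \<times> {1, -1})"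
  then obtain s t :: complex where P: "P = vec.span {node s t}" and st: "s ^ 2 = 1" "t ^ 2 = 1"
    by (auto simp: power2_eq_1_iff)
  let ?g = "\<lambda>f. grad f (node s t)"
  have "?g fermat_cone = 0"
    by (simp add: vec_eq_iff grad_def pderiv_fermat_cone cong: if_cong)
  then have "?g ` set example \<subseteq> vec.span {?g (quadric 1 weight), ?g (quadric 2 (\<lambda>_. 1))}"
    by (auto intro: vec.span_base vec.span_zero)
  then have "vec.dim (?g ` set example) \<le> card {?g (quadric 1 weight), ?g (quadric 2 (\<lambda>_. 1))}"
    by (intro vec.dim_le_card) auto
  also have "\<dots> < 3" by (simp add: card_insert_if)
  finally have "vec.dim (?g ` set example) < length example" by simp
  moreover have "\<forall>f\<in>set example. peval f (node s t) = 0"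
    using st by (simp add: peval_quadric peval_fermat_cone)
  moreover have "node s t \<noteq> 0"
    using node_nth(1)[of s t] by (metis zero_index zero_neq_one)
  ultimately show "P \<in> singular_locus example"
    unfolding singular_locus_def P by blast
qed

lemma node_eq_if_span_eq:
  assumes "node s t \<in> vec.span {node s' t'}"
  shows "s = s'" "t = t'"
proof -
  obtain k where k: "node s t = k *s node s' t'" using assms by (auto simp: vec.span_singleton)
  have k1: "k = 1" using arg_cong[OF k, of "\<lambda>v. v $ 0"] by simp
  show "s = s'" "t = t'"
    using arg_cong[OF k, of "\<lambda>v. v $ 1"] arg_cong[OF k, of "\<lambda>v. v $ 2"] k1 by simp_all
qed

lemma card_singular_locus_example: "card (singular_locus example) = 4"
proof -
  have "inj_on (\<lambda>(s, t). vec.span {node s t}) ({1, -1} \<times> {1, -1})"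
  proof (rule inj_onI, clarify)
    fix s t s' t' assume "vec.span {node s t} = vec.span {node s' t'}"
    then have "node s t \<in> vec.span {node s' t'}"
      using vec.span_base[of "node s t" "{node s t}"] by simp
    then show "s = s' \<and> t = t'" using node_eq_if_span_eq by blast
  qed
  then show ?thesis
    by (simp add: singular_locus_example card_image card_cartesian_product card_insert_if)
qed

lemma node_isolated:
  assumes "s \<in> {1, -1}" "t \<in> {1, -1}"
  shows "isolated_singular_point example (vec.span {node s t})"
proof -
  \<comment> \<open>The first factor vanishes at the points whose first sign is \<open>- s\<close>, the second one at those whose
    second sign is \<open>- t\<close>.\<close>
  let ?h = "(pvar 1 + pconst s * pvar 0) * (pvar 2 + pconst t * pvar 0) :: 7 cpoly"
  have "homogeneous (1 + 1) ?h"
    by (intro homogeneous_mult homogeneous_add homogeneous_pconst_mult homogeneous_pvar)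
  then have hom: "homogeneous 2 ?h" by (simp only: one_add_one)
  have "peval ?h (node s t) \<noteq> 0"
    using assms by (auto simp: peval_hom)
  moreover have "peval ?h v = 0" if Rs: "R \<in> singular_locus example - {vec.span {node s t}}" and vR: "v \<in> R" for R v
  proof -
    obtain s' t' where R: "R = vec.span {node s' t'}" and st': "s' \<in> {1, -1}" "t' \<in> {1, -1}"
      using Rs by (auto simp: singular_locus_example)
    then have "s' \<noteq> s \<or> t' \<noteq> t" using Rs by auto
    then have "s' = - s \<or> t' = - t" using st' assms by auto
    moreover obtain k where "v = k *s node s' t'" using vR R by (auto simp: vec.span_singleton)
    ultimately show ?thesis by (auto simp: peval_hom)
  qed
  moreover have "vec.span {node s t} \<in> singular_locus example"
    using assms by (auto simp: singular_locus_example)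
  ultimately show ?thesis
    unfolding isolated_singular_point_def using hom vec.span_base[of "node s t" "{node s t}"] by blast
qed

section \<open>The tangent cones\<close>

text \<open>The inclusion of the \<open>u\<close>-space, which is the tangent space at each singular point in the chart \<open>y\<^sub>0 = 1\<close>.\<close>

definition cone_matrix :: "complex ^ 4 ^ 7" where
  "cone_matrix = (\<chi> i j. if i = cone_coord j then 1 else 0)"

abbreviation cone_param :: "7 \<Rightarrow> 4 cpoly" where
  "cone_param \<equiv> \<lambda>i. \<Sum>j\<in>UNIV. pconst (cone_matrix $ i $ j) * pvar j"

lemma cone_param_simps [simp]:
  "cone_param 0 = 0" "cone_param 1 = 0" "cone_param 2 = 0" "cone_param (cone_coord j) = pvar j"
proof -
  have "pconst (cone_matrix $ cone_coord j $ k) * pvar k = (if j = k then pvar k else 0)" for k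
    by (simp add: cone_matrix_def)
  then show "cone_param (cone_coord j) = pvar j" by simp
qed (simp_all add: cone_matrix_def)

lemma rank_cone_matrix: "rank cone_matrix = 4"
proof -
  have "row (cone_coord j) cone_matrix = axis j 1" for j
    by (simp add: row_def cone_matrix_def axis_def vec_eq_iff)
  then have "axis j 1 \<in> rows cone_matrix" for j
    unfolding rows_def by (metis (mono_tags, lifting) UNIV_I mem_Collect_eq)
  then have "cart_basis \<subseteq> rows cone_matrix" by (auto simp: cart_basis_def)
  then have "vec.span (rows cone_matrix) = UNIV"
    using vec.span_mono[of cart_basis "rows cone_matrix"] by (simp add: span_cart_basis top.extremum_unique)
  then have "vec.dim (rows cone_matrix) = vec.dim (UNIV :: (complex ^ 4) set)"
    by (metis vec.dim_span)
  then show ?thesis by (simp add: row_rank_def_gen vec_dim_card del: vec.dim_UNIV)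
qed

lemma psubst_quadric:
  "psubst s (quadric k \<alpha>) = s k ^ 2 - s 0 ^ 2 + (\<Sum>j\<in>UNIV. pconst (of_real (\<alpha> j)) * s (cone_coord j) ^ 2)"
  by (simp add: quadric_def cone_quadric_def psubst_hom psubst_sum)

lemma psubst_fermat_cone: "psubst s fermat_cone = (\<Sum>j\<in>UNIV. s (cone_coord j) ^ 3)"
  by (simp add: fermat_cone_def psubst_hom psubst_sum)

lemma psubst_fermat_cubic: "psubst s fermat_cubic = (\<Sum>j\<in>UNIV. s j ^ 3)"
  by (simp add: fermat_cubic_def psubst_hom psubst_sum)

lemma translated_quadric:
  assumes "v $ k = c" "c ^ 2 = 1" "v $ 0 = 1" "\<And>j. v $ cone_coord j = 0"
  shows "psubst (\<lambda>i. pvar i + pconst (v $ i)) (quadric k \<alpha>)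
    = (pconst (2 * c) * pvar k - 2 * pvar 0) + (pvar k ^ 2 - pvar 0 ^ 2 + cone_quadric \<alpha>)"
proof -
  have "pconst c ^ 2 = (1 :: 7 cpoly)"
    using assms(2) by (simp add: power2_eq_square flip: pconst_mult)
  moreover have "pconst (2 * c) = 2 * (pconst c :: 7 cpoly)" by (simp add: pconst_mult)
  ultimately show ?thesis
    using assms by (simp add: psubst_quadric cone_quadric_def power2_sum algebra_simps)
qed

lemma translated_fermat_cone:
  assumes "\<And>j. v $ cone_coord j = 0"
  shows "psubst (\<lambda>i. pvar i + pconst (v $ i)) fermat_cone = fermat_cone"
  using assms by (simp add: psubst_fermat_cone) (simp add: fermat_cone_def)

lemma initial_form_translated_quadric:
  assumes "v $ k = c" "c ^ 2 = 1" "v $ 0 = 1" "\<And>j. v $ cone_coord j = 0" "k \<noteq> 0"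
  shows "initial_form (psubst (\<lambda>i. pvar i + pconst (v $ i)) (quadric k \<alpha>)) = pconst (2 * c) * pvar k - 2 * pvar 0"
proof -
  have "c \<noteq> 0" using assms(2) by auto
  then have "peval (pconst (2 * c) * pvar k - 2 * pvar 0) (axis k 1) \<noteq> 0"
    using assms(5) by (simp add: peval_hom axis_def)
  then have nz: "pconst (2 * c) * pvar k - 2 * pvar 0 \<noteq> 0" by auto
  have "homogeneous 2 (pvar k ^ 2 - pvar 0 ^ 2 + cone_quadric \<alpha>)"
    by (intro homogeneous_add homogeneous_diff homogeneous_pvar_power homogeneous_cone_quadric)
  then have "ord_ge (Suc 1) (pvar k ^ 2 - pvar 0 ^ 2 + cone_quadric \<alpha>)"
    by (simp add: homogeneous_ord_ge numeral_2_eq_2)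
  moreover have "homogeneous 1 (pconst (2 * c) * pvar k - 2 * pvar 0)"
    using homogeneous_pconst_mult[OF homogeneous_pvar, of 2 0]
    by (intro homogeneous_diff homogeneous_pconst_mult homogeneous_pvar) simp
  ultimately show ?thesis
    unfolding translated_quadric[OF assms(1-4)] using nz by (intro initial_form_eqI)
qed

lemma initial_form_homogeneous: "homogeneous d p \<Longrightarrow> initial_form p = p"
  using initial_form_eqI[of d p 0] by (cases "p = 0") auto

text \<open>The translated equations have initial forms \<open>y\<^sub>0\<close>, \<open>2 s y\<^sub>1 - 2 y\<^sub>0\<close>, \<open>2 t y\<^sub>2 - 2 y\<^sub>0\<close> and the cubic itself,
  and these four generate the ideal on the right-hand side. That no other initial forms occur follows from
  \<open>initial_form_pullback_in_span\<close>: in the chart \<open>y\<^sub>0 = 1\<close> the quadrics can be solved for \<open>y\<^sub>1\<close> and \<open>y\<^sub>2\<close> as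
  functions of \<open>u\<close>, to any order.\<close>

lemma tangent_cone_at_node:
  assumes "s ^ 2 = 1" "t ^ 2 = 1"
  shows "tangent_cone_ideal (ideal.span (insert (pvar 0 - 1) (set example))) (node s t)
    = {g. psubst cone_param g \<in> ideal.span {fermat_cubic}}"
    (is "tangent_cone_ideal (ideal.span ?G) _ = ?T")
proof -
  let ?v = "node s t"
  let ?\<tau> = "\<lambda>i. pvar i + pconst (?v $ i) :: 7 cpoly"
  let ?J = "tangent_cone_ideal (ideal.span ?G) ?v"
  have J: "?J = ideal.span ((\<lambda>f. initial_form (psubst ?\<tau> f)) ` ideal.span ?G)"
    by (simp add: tangent_cone_ideal_def)
  have tr_chart: "psubst ?\<tau> (pvar 0 - 1) = pvar 0"
    by (simp add: psubst_diff)
  note tr1 = translated_quadric[of ?v 1 s weight, OF node_nth(2) assms(1) node_nth(1) node_nth(4)]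
  note tr2 = translated_quadric[of ?v 2 t "\<lambda>_. 1", OF node_nth(3) assms(2) node_nth(1) node_nth(4)]
  note tr3 = translated_fermat_cone[of ?v, OF node_nth(4)]
  have st: "s \<noteq> 0" "t \<noteq> 0" using assms by auto
  show ?thesis
  proof (intro equalityI)
    have "initial_form (psubst ?\<tau> f) \<in> ?T" if "f \<in> ideal.span ?G" for f
    proof -
      have "psubst cone_param (initial_form (psubst ?\<tau> f)) \<in> ideal.span {fermat_cubic}"
      proof (rule initial_form_pullback_in_span[OF homogeneous_fermat_cubic])
        show "homogeneous 1 (cone_param i)" for i
          by (intro homogeneous_sum homogeneous_pconst_mult homogeneous_pvar)
        show "psubst ?\<tau> f \<in> ideal.span (psubst ?\<tau> ` ?G)" by (rule psubst_span[OF that])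
        fix N
        define r :: "(4 \<Rightarrow> real) \<Rightarrow> 4 cpoly" where
          "r \<alpha> = (\<Sum>j\<in>UNIV. pconst (of_real (\<alpha> j)) * pvar j ^ 2)" for \<alpha>
        have r: "ord_ge 2 (r \<alpha>)" for \<alpha>
          unfolding r_def
          by (intro ord_ge_sum ord_ge_mult_left homogeneous_ord_ge homogeneous_pvar_power)
        obtain \<phi> where \<phi>: "ord_ge 2 \<phi>" "ord_ge N (pconst (2 * s) * \<phi> + \<phi> ^ 2 + r weight)"
          using approximate_root[OF _ r, of "2 * s"] st by auto
        obtain \<psi> where \<psi>: "ord_ge 2 \<psi>" "ord_ge N (pconst (2 * t) * \<psi> + \<psi> ^ 2 + r (\<lambda>_. 1))"
          using approximate_root[OF _ r, of "2 * t"] st by auto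
        \<comment> \<open>A parametrization by \<open>u\<close> of the intersection of the translated quadrics in the chart, up to order \<open>N\<close>.\<close>
        define \<sigma> where "\<sigma> i = (if i = 1 then \<phi> else if i = 2 then \<psi> else cone_param i)" for i
        have \<sigma>: "\<sigma> 0 = 0" "\<sigma> 1 = \<phi>" "\<sigma> 2 = \<psi>" "\<sigma> (cone_coord j) = pvar j" for j
          by (simp_all add: \<sigma>_def del: cone_param_simps) simp_all
        have "ord_ge 2 (\<sigma> i - cone_param i)" for i
          using \<phi>(1) \<psi>(1) by (cases i rule: coord_cases) (simp_all add: \<sigma>)
        moreover have "\<exists>w. ord_ge N (psubst \<sigma> g - w * fermat_cubic)" if g: "g \<in> psubst ?\<tau> ` ?G" for g
        proof -
          have "psubst \<sigma> (psubst ?\<tau> (pvar 0 - 1)) = 0"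
            by (simp add: tr_chart \<sigma>)
          moreover have "psubst \<sigma> (psubst ?\<tau> (quadric 1 weight)) = pconst (2 * s) * \<phi> + \<phi> ^ 2 + r weight"
            "psubst \<sigma> (psubst ?\<tau> (quadric 2 (\<lambda>_. 1))) = pconst (2 * t) * \<psi> + \<psi> ^ 2 + r (\<lambda>_. 1)"
            unfolding tr1 tr2 cone_quadric_def by (simp_all add: psubst_hom psubst_sum \<sigma> r_def)
          moreover have "psubst \<sigma> (psubst ?\<tau> fermat_cone) = fermat_cubic"
            by (simp add: tr3 psubst_fermat_cone \<sigma> fermat_cubic_def)
          ultimately have "ord_ge N (psubst \<sigma> g - 0 * fermat_cubic) \<or> ord_ge N (psubst \<sigma> g - 1 * fermat_cubic)"
            using g \<phi>(2) \<psi>(2) by auto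
          then show ?thesis by blast
        qed
        ultimately show "\<exists>\<sigma>. (\<forall>i. ord_ge 2 (\<sigma> i - cone_param i)) \<and>
            (\<forall>g\<in>psubst ?\<tau> ` ?G. \<exists>w. ord_ge N (psubst \<sigma> g - w * fermat_cubic))"
          by blast
      qed
      then show ?thesis by simp
    qed
    moreover have "ideal.subspace ?T"
      by (auto simp: ideal.subspace_def psubst_add psubst_mult
          intro: ideal.span_zero ideal.span_add ideal.span_scale)
    ultimately show "?J \<subseteq> ?T"
      unfolding J by (intro ideal.span_minimal) auto
  next
    have gen: "initial_form (psubst ?\<tau> g) \<in> ?J" if "g \<in> ?G" for g
      unfolding J using that by (intro ideal.span_base imageI ideal.span_base)
    have x0: "pvar 0 \<in> ?J"
      using gen[of "pvar 0 - 1"] by (simp add: tr_chart initial_form_homogeneous[OF homogeneous_pvar])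
    have add: "a + b \<in> ?J" if "a \<in> ?J" "b \<in> ?J" for a b
      using that unfolding J by (rule ideal.span_add)
    have scale: "a * b \<in> ?J" if "b \<in> ?J" for a b
      using that unfolding J by (rule ideal.span_scale)
    have axis: "pvar k \<in> ?J" if "pconst (2 * c) * pvar k - 2 * pvar 0 \<in> ?J" "c \<noteq> 0" for c k
    proof -
      have k: "pvar k = pconst (1 / (2 * c)) * ((pconst (2 * c) * pvar k - 2 * pvar 0) + 2 * pvar 0)"
        using that(2) by (simp add: mult.assoc[symmetric] flip: pconst_mult)
      show ?thesis
        by (subst k) (intro scale add that(1) x0)
    qed
    have x1: "pvar 1 \<in> ?J"
      using gen[of "quadric 1 weight"] st
      by (intro axis[of s]) (simp_all add: initial_form_translated_quadric[of ?v 1 s] assms)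
    have x2: "pvar 2 \<in> ?J"
      using gen[of "quadric 2 (\<lambda>_. 1)"] st
      by (intro axis[of t]) (simp_all add: initial_form_translated_quadric[of ?v 2 t] assms)
    have C: "fermat_cone \<in> ?J"
      using gen[of fermat_cone]
      by (simp add: tr3 initial_form_homogeneous[OF homogeneous_fermat_cone])
    show "?T \<subseteq> ?J"
    proof
      fix g assume "g \<in> ?T"
      then obtain w where w: "psubst cone_param g = w * fermat_cubic"
        by (auto simp: ideal.span_singleton)
      \<comment> \<open>Restriction to the \<open>u\<close>-space followed by the projection onto it only drops \<open>y\<^sub>0, y\<^sub>1, y\<^sub>2\<close>.\<close>
      let ?\<iota> = "\<lambda>j. pvar (cone_coord j) :: 7 cpoly"
      have "psubst pvar g - psubst (\<lambda>i. psubst ?\<iota> (cone_param i)) g \<in> ideal.span {pvar 0, pvar 1, pvar 2}"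
      proof (rule psubst_cong_mod)
        show "pvar i - psubst ?\<iota> (cone_param i) \<in> ideal.span {pvar 0, pvar 1, pvar 2}" for i
          by (cases i rule: coord_cases) (simp_all add: ideal.span_base ideal.span_zero)
      qed
      also have "ideal.span {pvar 0, pvar 1, pvar 2} \<subseteq> ?J"
        using x0 x1 x2 unfolding J by (intro ideal.span_minimal) (auto simp: ideal.subspace_span)
      finally have "g - psubst ?\<iota> (psubst cone_param g) \<in> ?J"
        by (simp add: psubst_id psubst_psubst)
      moreover have "psubst ?\<iota> (psubst cone_param g) = psubst ?\<iota> w * fermat_cone"
        by (simp add: w psubst_mult psubst_fermat_cubic fermat_cone_def)
      ultimately have "(g - psubst ?\<iota> w * fermat_cone) + psubst ?\<iota> w * fermat_cone \<in> ?J"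
        by (intro add scale C) simp
      then show "g \<in> ?J" by simp
    qed
  qed
qed

lemma node_triple_point:
  assumes "s \<in> {1, -1}" "t \<in> {1, -1}"
  shows "ordinary_triple_point example (vec.span {node s t})"
proof -
  have sq: "s ^ 2 = 1" "t ^ 2 = 1" using assms by auto
  have "cone_over_smooth_cubic_surface
      (tangent_cone_ideal (ideal.span (insert (pvar 0 - 1) (set example))) (node s t))"
    unfolding cone_over_smooth_cubic_surface_def tangent_cone_at_node[OF sq]
    using rank_cone_matrix singular_locus_fermat_cubic homogeneous_fermat_cubic fermat_cubic_nz
    by (intro exI[of _ cone_matrix] exI[of _ fermat_cubic]) (simp add: hypersurface_eq_def)
  then show ?thesis
    unfolding ordinary_triple_point_def
    using node_isolated[OF assms] node_nth(1)[of s t] by blast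
qed

theorem theorem4p1:
  shows "\<exists>Q\<^sub>1 Q\<^sub>2 C :: 7 cpoly.
    hypersurface_eq 2 Q\<^sub>1 \<and> hypersurface_eq 2 Q\<^sub>2 \<and> hypersurface_eq 3 C \<and>
    complete_intersection [Q\<^sub>1, Q\<^sub>2, C] \<and>
    card (singular_locus [Q\<^sub>1, Q\<^sub>2, C]) = 4 \<and>
    (\<forall>P\<in>singular_locus [Q\<^sub>1, Q\<^sub>2, C]. ordinary_triple_point [Q\<^sub>1, Q\<^sub>2, C] P)"
proof (intro exI conjI)
  show "hypersurface_eq 2 (quadric 1 weight)" "hypersurface_eq 2 (quadric 2 (\<lambda>_. 1))"
    by (simp_all add: hypersurface_quadric)
  show "hypersurface_eq 3 fermat_cone"
    by (simp add: hypersurface_eq_def fermat_cone_nz homogeneous_fermat_cone)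
  show "complete_intersection example" by (rule complete_intersection_example)
  show "card (singular_locus example) = 4" by (rule card_singular_locus_example)
  show "\<forall>P\<in>singular_locus example. ordinary_triple_point example P"
    using node_triple_point by (auto simp: singular_locus_example)
qed

end
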